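(* Let $\{\Omega_a\}_{a=1,2,3}\cup\{\Omega_I\}_{I=1,\dots,19}$ be a basis of $H^2(K3,\mathbb{R})$ such that $\langle\Omega_a,\Omega_I\rangle=0$ for all $a,I$, and let $\mathcal{K}_{ab}=\langle\Omega_a,\Omega_b\rangle$, $\mathcal{K}_{IJ}=\langle\Omega_I,\Omega_J\rangle$, with inverse matrices $(\mathcal{K}^{ab})$ and $(\mathcal{K}^{IJ})$. Let $\{\alpha_\Lambda\}_{\Lambda=1,\dots,22}$ be a basis of $H^2(K3,\mathbb{R})$, let $p^1,\dots,p^{22}$ be integers, and put $\mathcal{H}_2=\sum_{\Lambda=1}^{22}p^\Lambda\alpha_\Lambda$. Define $Z_a=\int_{K3}\mathcal{H}_2\wedge\Omega_a$ and $Z_I=\int_{K3}\mathcal{H}_2\wedge\Omega_I$. Then $$\mathcal{H}_2=\sum_{a,b=1}^{3}\mathcal{K}^{ab}Z_a\,\Omega_b+\sum_{I,J=1}^{19}\mathcal{K}^{IJ}Z_I\,\Omega_J .$$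
   Context: $K3$ denotes a K3 surface, with $\dim H^2(K3,\mathbb{R})=22$. The bilinear form $\langle F,G\rangle=\int_{K3}F\wedge G$ on $H^2(K3,\mathbb{R})$ is symmetric and nondegenerate (signature $(3,19)$); hence the Gram matrices $(\mathcal{K}_{ab})$ ($3\times 3$) and $(\mathcal{K}_{IJ})$ ($19\times 19$) of the mutually orthogonal families $\{\Omega_a\}$ and $\{\Omega_I\}$ are symmetric and invertible. Indices $a,b$ run over $1,2,3$ and $I,J$ over $1,\dots,19$. *)

theory Defs
  imports "HOL-Analysis.Analysis"
begin

section \<open>Smooth and holomorphic functions on open subsets of \<open>\<complex>\<^sup>2\<close>\<close>

text \<open>The set \<open>S\<close> is meant to be open, and derivatives are real Frechet derivatives.\<close>

primrec Ck_on :: "nat \<Rightarrow> 'b::euclidean_space set \<Rightarrow> ('b \<Rightarrow> 'c::real_normed_vector) \<Rightarrow> bool" where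
  "Ck_on 0 S f \<longleftrightarrow> continuous_on S f"
| "Ck_on (Suc k) S f \<longleftrightarrow>
     (\<forall>x\<in>S. f differentiable (at x)) \<and> (\<forall>v. Ck_on k S (\<lambda>x. frechet_derivative f (at x) v))"

definition smooth_on :: "'b::euclidean_space set \<Rightarrow> ('b \<Rightarrow> 'c::real_normed_vector) \<Rightarrow> bool" where
  "smooth_on S f \<longleftrightarrow> (\<forall>k. Ck_on k S f)"

text \<open>A function of two complex variables is holomorphic if its real derivative is everywhere
  complex linear. Smoothness is then automatic (on open sets); it is included for convenience.\<close>

definition holomorphic2_on :: "(complex^2) set \<Rightarrow> (complex^2 \<Rightarrow> complex) \<Rightarrow> bool" where
  "holomorphic2_on S f \<longleftrightarrow> smooth_on S f \<and>
     (\<forall>x\<in>S. \<forall>c v. frechet_derivative f (at x) (c *s v) = c * frechet_derivative f (at x) v)"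

section \<open>Complex surfaces\<close>

text \<open>A chart is a pair of its domain and its coordinate map.\<close>

type_synonym 'a chart = "'a set \<times> ('a \<Rightarrow> complex^2)"

definition chart_image :: "'a chart \<Rightarrow> (complex^2) set" where
  "chart_image c = snd c ` fst c"

definition chart_inv :: "'a chart \<Rightarrow> complex^2 \<Rightarrow> 'a" where
  "chart_inv c = inv_into (fst c) (snd c)"

definition overlap :: "'a chart \<Rightarrow> 'a chart \<Rightarrow> (complex^2) set" where
  "overlap c d = snd c ` (fst c \<inter> fst d)"

definition transition :: "'a chart \<Rightarrow> 'a chart \<Rightarrow> complex^2 \<Rightarrow> complex^2" where
  "transition c d = snd d \<circ> chart_inv c"

definition dtransition :: "'a chart \<Rightarrow> 'a chart \<Rightarrow> complex^2 \<Rightarrow> complex^2 \<Rightarrow> complex^2" where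
  "dtransition c d x = frechet_derivative (transition c d) (at x)"

definition complex_surface :: "'a::t2_space set \<Rightarrow> 'a chart set \<Rightarrow> bool" where
  "complex_surface M A \<longleftrightarrow>
     (\<Union>c\<in>A. fst c) = M \<and>
     (\<forall>c\<in>A. openin (top_of_set M) (fst c) \<and> open (chart_image c) \<and>
        homeomorphism (fst c) (chart_image c) (snd c) (chart_inv c)) \<and>
     (\<forall>c\<in>A. \<forall>d\<in>A. \<forall>i. holomorphic2_on (overlap c d) (\<lambda>x. transition c d x $ i))"

text \<open>In a chart with coordinates \<open>z\<^sub>1, z\<^sub>2\<close>, a holomorphic 2-form is \<open>h c dz\<^sub>1 \<and> dz\<^sub>2\<close> with
  \<open>h c\<close> holomorphic; the coefficients transform with the complex Jacobian determinant.\<close>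

definition nonvanishing_holomorphic_2form ::
    "'a::t2_space chart set \<Rightarrow> ('a chart \<Rightarrow> complex^2 \<Rightarrow> complex) \<Rightarrow> bool" where
  "nonvanishing_holomorphic_2form A h \<longleftrightarrow>
     (\<forall>c\<in>A. holomorphic2_on (chart_image c) (h c) \<and> (\<forall>x\<in>chart_image c. h c x \<noteq> 0)) \<and>
     (\<forall>c\<in>A. \<forall>d\<in>A. \<forall>x\<in>overlap c d.
        h c x = h d (transition c d x) * det (matrix (dtransition c d x)))"

definition K3_surface :: "'a::t2_space set \<Rightarrow> 'a chart set \<Rightarrow> bool" where
  "K3_surface M A \<longleftrightarrow> complex_surface M A \<and> M \<noteq> {} \<and> compact M \<and> simply_connected M \<and>
     (\<exists>h. nonvanishing_holomorphic_2form A h)"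

section \<open>Real differential forms\<close>

text \<open>A form is given by its local expressions: \<open>\<omega> c x v\<^sub>1 \<dots> v\<^sub>k\<close> is its value in the chart \<open>c\<close>
  at the coordinate point \<open>x\<close> on the tangent vectors \<open>v\<^sub>1, \<dots>, v\<^sub>k\<close> in \<open>\<complex>\<^sup>2 = \<real>\<^sup>4\<close>, and the
  local expressions are related by pull-back along the transition maps. Values for charts outside
  the atlas, or for points outside the chart image, carry no meaning.\<close>

type_synonym 'a form1 = "'a chart \<Rightarrow> complex^2 \<Rightarrow> complex^2 \<Rightarrow> real"
type_synonym 'a form2 = "'a chart \<Rightarrow> complex^2 \<Rightarrow> complex^2 \<Rightarrow> complex^2 \<Rightarrow> real"
type_synonym 'a form4 =
  "'a chart \<Rightarrow> complex^2 \<Rightarrow> complex^2 \<Rightarrow> complex^2 \<Rightarrow> complex^2 \<Rightarrow> complex^2 \<Rightarrow> real"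

definition smooth_1form :: "'a chart set \<Rightarrow> 'a form1 \<Rightarrow> bool" where
  "smooth_1form A \<beta> \<longleftrightarrow>
     (\<forall>c\<in>A. (\<forall>x\<in>chart_image c. linear (\<beta> c x)) \<and>
            (\<forall>u. smooth_on (chart_image c) (\<lambda>x. \<beta> c x u))) \<and>
     (\<forall>c\<in>A. \<forall>d\<in>A. \<forall>x\<in>overlap c d. \<forall>u.
        \<beta> c x u = \<beta> d (transition c d x) (dtransition c d x u))"

definition smooth_2form :: "'a chart set \<Rightarrow> 'a form2 \<Rightarrow> bool" where
  "smooth_2form A F \<longleftrightarrow>
     (\<forall>c\<in>A. (\<forall>x\<in>chart_image c. bilinear (F c x) \<and> (\<forall>u v. F c x u v = - F c x v u)) \<and>
            (\<forall>u v. smooth_on (chart_image c) (\<lambda>x. F c x u v))) \<and>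
     (\<forall>c\<in>A. \<forall>d\<in>A. \<forall>x\<in>overlap c d. \<forall>u v.
        F c x u v = F d (transition c d x) (dtransition c d x u) (dtransition c d x v))"

definition d1 :: "'a form1 \<Rightarrow> 'a form2" where
  "d1 \<beta> c x u v =
     frechet_derivative (\<lambda>y. \<beta> c y v) (at x) u - frechet_derivative (\<lambda>y. \<beta> c y u) (at x) v"

definition closed_2form :: "'a chart set \<Rightarrow> 'a form2 \<Rightarrow> bool" where
  "closed_2form A F \<longleftrightarrow> smooth_2form A F \<and>
     (\<forall>c\<in>A. \<forall>x\<in>chart_image c. \<forall>u v w.
        frechet_derivative (\<lambda>y. F c y v w) (at x) u
        - frechet_derivative (\<lambda>y. F c y u w) (at x) v
        + frechet_derivative (\<lambda>y. F c y u v) (at x) w = 0)"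

definition wedge :: "'a form2 \<Rightarrow> 'a form2 \<Rightarrow> 'a form4" where
  "wedge F G c x v1 v2 v3 v4 =
     F c x v1 v2 * G c x v3 v4 - F c x v1 v3 * G c x v2 v4 + F c x v1 v4 * G c x v2 v3
     + F c x v2 v3 * G c x v1 v4 - F c x v2 v4 * G c x v1 v3 + F c x v3 v4 * G c x v1 v2"

section \<open>Integration of 4-forms\<close>

text \<open>The manifold carries the complex orientation, for which \<open>e\<^sub>1, i e\<^sub>1, e\<^sub>2, i e\<^sub>2\<close> is a
  positive basis in every chart. Since only integration is involved, continuous partitions of
  unity suffice; the value does not depend on the chosen one.\<close>

definition partition_of_unity :: "'a::t2_space set \<Rightarrow> 'a chart set \<Rightarrow> ('a chart \<Rightarrow> 'a \<Rightarrow> real) \<Rightarrow> bool" where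
  "partition_of_unity M A \<rho> \<longleftrightarrow>
     finite {c\<in>A. \<exists>p\<in>M. \<rho> c p \<noteq> 0} \<and>
     (\<forall>c\<in>A. continuous_on M (\<rho> c) \<and> (\<forall>p\<in>M. 0 \<le> \<rho> c p) \<and>
        M \<inter> closure {p\<in>M. \<rho> c p \<noteq> 0} \<subseteq> fst c) \<and>
     (\<forall>p\<in>M. (\<Sum>c\<in>{c\<in>A. \<exists>q\<in>M. \<rho> c q \<noteq> 0}. \<rho> c p) = 1)"

definition density :: "'a form4 \<Rightarrow> 'a chart \<Rightarrow> complex^2 \<Rightarrow> real" where
  "density \<eta> c x = \<eta> c x (axis 1 1) (axis 1 \<i>) (axis 2 1) (axis 2 \<i>)"

definition manifold_integral :: "'a::t2_space set \<Rightarrow> 'a chart set \<Rightarrow> 'a form4 \<Rightarrow> real" where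
  "manifold_integral M A \<eta> =
     (let \<rho> = SOME \<rho>. partition_of_unity M A \<rho>
      in \<Sum>c\<in>{c\<in>A. \<exists>p\<in>M. \<rho> c p \<noteq> 0}.
           (LINT x:chart_image c|lborel. \<rho> c (chart_inv c x) * density \<eta> c x))"

section \<open>Second de Rham cohomology\<close>

definition cohomologous :: "'a chart set \<Rightarrow> ('a form2 \<times> 'a form2) set" where
  "cohomologous A = {(F, G). closed_2form A F \<and> closed_2form A G \<and>
     (\<exists>\<beta>. smooth_1form A \<beta> \<and>
        (\<forall>c\<in>A. \<forall>x\<in>chart_image c. \<forall>u v. F c x u v - G c x u v = d1 \<beta> c x u v))}"

definition H2 :: "'a chart set \<Rightarrow> 'a form2 set set" where
  "H2 A = {F. closed_2form A F} // cohomologous A"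

definition cls :: "'a chart set \<Rightarrow> 'a form2 \<Rightarrow> 'a form2 set" where
  "cls A F = cohomologous A `` {F}"

definition rep :: "'a form2 set \<Rightarrow> 'a form2" where
  "rep C = (SOME F. F \<in> C)"

definition H2_zero :: "'a chart set \<Rightarrow> 'a form2 set" where
  "H2_zero A = cls A (\<lambda>c x u v. 0)"

definition H2_add :: "'a chart set \<Rightarrow> 'a form2 set \<Rightarrow> 'a form2 set \<Rightarrow> 'a form2 set" where
  "H2_add A C D = cls A (\<lambda>c x u v. rep C c x u v + rep D c x u v)"

definition H2_lincomb ::
    "'a chart set \<Rightarrow> ('i::finite \<Rightarrow> real) \<Rightarrow> ('i \<Rightarrow> 'a form2 set) \<Rightarrow> 'a form2 set" where
  "H2_lincomb A k C = cls A (\<lambda>c x u v. \<Sum>i\<in>UNIV. k i * rep (C i) c x u v)"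

definition H2_basis :: "'a chart set \<Rightarrow> ('i::finite \<Rightarrow> 'a form2 set) \<Rightarrow> bool" where
  "H2_basis A B \<longleftrightarrow> (\<forall>i. B i \<in> H2 A) \<and>
     (\<forall>k. H2_lincomb A k B = H2_zero A \<longrightarrow> (\<forall>i. k i = 0)) \<and>
     (\<forall>C\<in>H2 A. \<exists>k. C = H2_lincomb A k B)"

definition intersection_form :: "'a::t2_space set \<Rightarrow> 'a chart set \<Rightarrow> 'a form2 set \<Rightarrow> 'a form2 set \<Rightarrow> real" where
  "intersection_form M A C D = manifold_integral M A (wedge (rep C) (rep D))"

end

theory Submission
  imports Defs
begin

text \<open>Expand the class of \<open>\<H>\<close> in the first basis; pairing the expansion with the basis and
  inverting the two Gram blocks recovers the coefficients. The substance is that pairings may be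
  computed on arbitrary representatives, i.e. that \<open>\<integral> d\<beta> \<and> G = 0\<close> for closed \<open>G\<close>. For this, a
  continuously differentiable partition of unity reduces to 4-forms supported in one chart; there the
  integral of an exact form vanishes because the integral of a directional derivative does. That
  such an integral may be computed in one chart, although the integral is defined through some
  unknown continuous partition of unity, is the change of variables formula: holomorphic transition
  maps have the nonnegative real Jacobian \<open>\<bar>det\<bar>\<^sup>2\<close>.\<close>

section \<open>Complex-linear maps and change of variables in \<open>\<complex>\<^sup>2\<close>\<close>

text \<open>The classes in \<open>H2_lincomb\<close>, \<open>H2_add\<close> and
  \<open>intersection_form\<close> all enter through a chosen representative \<open>rep\<close>, so
  even additivity of the pairing is a theorem, and it rests on Stokes. The obstacle is that
  \<open>manifold_integral\<close> picks its partition of unity by choice among merely continuous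
  ones, which cannot be differentiated. Therefore two partitions occur. The chosen one,
  \<open>pou\<close>, disappears by summing to 1 once all its summands have been moved into a single
  chart. The other one, \<open>\<sigma>\<close>, is constructed and localises the exact form. Class
  C^1 is what a single integration by parts asks of it, and this permits the elementary bump
  \<open>(max 0 (r\<^sup>2 - dist\<^sup>2))\<^sup>2\<close>. On the algebraic side, orthogonality
  makes the Gram matrix of the whole basis block diagonal, so that \<open>Z\<close> sees only the
  coefficients along \<open>\<Omega>\<close> and \<open>Z'\<close> only those along
  \<open>\<Omega>'\<close>.\<close>

lemma det_4:
  "det (A::'a::comm_ring_1^4^4) =
    A$1$1 * (A$2$2 * (A$3$3*A$4$4 - A$3$4*A$4$3) - A$2$3 * (A$3$2*A$4$4 - A$3$4*A$4$2) + A$2$4 * (A$3$2*A$4$3 - A$3$3*A$4$2))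
  - A$1$2 * (A$2$1 * (A$3$3*A$4$4 - A$3$4*A$4$3) - A$2$3 * (A$3$1*A$4$4 - A$3$4*A$4$1) + A$2$4 * (A$3$1*A$4$3 - A$3$3*A$4$1))
  + A$1$3 * (A$2$1 * (A$3$2*A$4$4 - A$3$4*A$4$2) - A$2$2 * (A$3$1*A$4$4 - A$3$4*A$4$1) + A$2$4 * (A$3$1*A$4$2 - A$3$2*A$4$1))
  - A$1$4 * (A$2$1 * (A$3$2*A$4$3 - A$3$3*A$4$2) - A$2$2 * (A$3$1*A$4$3 - A$3$3*A$4$1) + A$2$3 * (A$3$1*A$4$2 - A$3$2*A$4$1))"
proof -
  \<comment> \<open>Permutations of the four indices are generated by adjoining one index at a time,
    which turns the sum over permutations into nested sums.\<close>
  have f1: "finite {2::4,3,4}" "1 \<notin> {2::4,3,4}" by auto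
  have f2: "finite {3::4,4}" "2 \<notin> {3::4,4}" by auto
  have f3: "finite {4::4}" "3 \<notin> {4::4}" by auto
  show ?thesis
    unfolding det_def UNIV_4 sum_over_permutations_insert[OF f1] sum_over_permutations_insert[OF f2]
      sum_over_permutations_insert[OF f3] permutes_sing
    by (simp add: sign_swap_id permutation_swap_id permutation_compose sign_compose sign_id swap_id_eq algebra_simps)
qed

text \<open>The coordinates follow the order of the positive basis used in \<open>density\<close>.
  The passage to \<open>real^4\<close> makes real Jacobian determinants and the change of variables
  theorem for \<open>real^'n\<close> applicable.\<close>

definition to_real4 :: "complex^2 \<Rightarrow> real^4" where
  "to_real4 x = (\<chi> i. if i = 1 then Re (x$1) else if i = 2 then Im (x$1) else if i = 3 then Re (x$2) else Im (x$2))"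

definition of_real4 :: "real^4 \<Rightarrow> complex^2" where
  "of_real4 y = vector [Complex (y$1) (y$2), Complex (y$3) (y$4)]"

lemma to_real4_nth [simp]:
  "to_real4 x $ 1 = Re (x$1)" "to_real4 x $ 2 = Im (x$1)"
  "to_real4 x $ 3 = Re (x$2)" "to_real4 x $ 4 = Im (x$2)"
  by (simp_all add: to_real4_def)

lemma of_real4_nth [simp]:
  "of_real4 y $ 1 = Complex (y$1) (y$2)" "of_real4 y $ 2 = Complex (y$3) (y$4)"
  by (simp_all add: of_real4_def)

lemma of_real4_to_real4 [simp]: "of_real4 (to_real4 x) = x"
  by (simp add: vec_eq_iff forall_2)

lemma to_real4_of_real4 [simp]: "to_real4 (of_real4 y) = y"
  by (simp add: vec_eq_iff forall_4)

lemma linear_to_real4: "linear to_real4"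
  by (rule linearI) (simp_all add: vec_eq_iff forall_4)

lemma linear_of_real4: "linear of_real4"
  by (rule linearI) (simp_all add: vec_eq_iff forall_2 complex_eq_iff)

text \<open>Lebesgue measure is determined by its values on boxes, and \<open>to_real4\<close> pulls
  a box back to a box with the same side lengths.\<close>

lemma lborel_eq_distr_to_real4: "lborel = distr lborel borel to_real4"
proof (rule lborel_eqI)
  have [measurable]: "to_real4 \<in> borel \<rightarrow>\<^sub>M borel"
    by (intro borel_measurable_continuous_onI linear_continuous_on) (simp add: linear_to_real4 linear_conv_bounded_linear[symmetric])
  fix l u :: "real^4" assume le: "\<And>b. b \<in> Basis \<Longrightarrow> l \<bullet> b \<le> u \<bullet> b"
  have B4: "Basis = {axis 1 1, axis 2 1, axis 3 1, axis 4 1 :: real^4}"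
    by (auto simp: Basis_vec_def UNIV_4)
  have B2: "Basis = {axis 1 1, axis 1 \<i>, axis 2 1, axis 2 \<i> :: complex^2}"
    by (auto simp: Basis_vec_def UNIV_2 Basis_complex_def)
  have eq: "to_real4 -` box l u = box (of_real4 l) (of_real4 u)"
    by (auto simp: box_def B4 B2 inner_axis)
  have "emeasure (distr lborel borel to_real4) (box l u) = emeasure lborel (box (of_real4 l) (of_real4 u))"
    by (subst emeasure_distr) (auto simp: eq)
  also have "\<dots> = (\<Prod>b\<in>Basis. (u - l) \<bullet> b)"
  proof -
    have "l$1 \<le> u$1" "l$2 \<le> u$2" "l$3 \<le> u$3" "l$4 \<le> u$4"
      using le[of "axis 1 1"] le[of "axis 2 1"] le[of "axis 3 1"] le[of "axis 4 1"]
      by (simp_all add: B4 inner_axis)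
    then show ?thesis
      by (simp add: emeasure_lborel_box_eq B4 B2 inner_axis axis_eq_axis linear_diff[OF linear_of_real4])
  qed
  finally show "emeasure (distr lborel borel to_real4) (box l u) = (\<Prod>b\<in>Basis. (u - l) \<bullet> b)" .
qed simp

lemma lborel_integral_of_real4:
  fixes h :: "complex^2 \<Rightarrow> real"
  assumes "set_integrable lborel U h"
  shows "(LINT y:to_real4 ` U|lborel. h (of_real4 y)) = (LINT x:U|lborel. h x)"
    and "set_integrable lborel (to_real4 ` U) (\<lambda>y. h (of_real4 y))"
proof -
  have m: "to_real4 \<in> borel_measurable lborel" "of_real4 \<in> borel_measurable borel"
    by (auto intro!: borel_measurable_continuous_onI linear_continuous_on simp: linear_to_real4 linear_of_real4 linear_conv_bounded_linear[symmetric])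
  \<comment> \<open>Extended by zero, the integrand is measurable because it is integrable, although
    neither \<open>U\<close> nor \<open>h\<close> is assumed measurable.\<close>
  define k where "k = (\<lambda>x. indicator U x *\<^sub>R h x)"
  have k: "integrable lborel k"
    using assms by (simp add: k_def set_integrable_def)
  have km: "(\<lambda>y. k (of_real4 y)) \<in> borel_measurable borel"
    using measurable_compose[OF m(2), of k] k by simp
  have "y \<in> to_real4 ` U \<longleftrightarrow> of_real4 y \<in> U" for y
    by (metis imageE image_eqI of_real4_to_real4 to_real4_of_real4)
  then have eq: "indicator (to_real4 ` U) y *\<^sub>R h (of_real4 y) = k (of_real4 y)" for y
    by (simp add: k_def indicator_def)
  show "(LINT y:to_real4 ` U|lborel. h (of_real4 y)) = (LINT x:U|lborel. h x)"
    unfolding set_lebesgue_integral_def eq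
    by (subst lborel_eq_distr_to_real4, subst integral_distr[OF m(1) km]) (simp add: k_def)
  show "set_integrable lborel (to_real4 ` U) (\<lambda>y. h (of_real4 y))"
    unfolding set_integrable_def eq
    by (subst lborel_eq_distr_to_real4, subst integrable_distr_eq[OF m(1) km]) (simp add: k)
qed

text \<open>The general theorem concerns gauge integrals of vector-valued functions. Real functions
  are embedded as \<open>real^1\<close>-valued ones, and integrability on both sides allows the
  return to Lebesgue integrals.\<close>

lemma lborel_integral_change_of_variables_1:
  fixes f :: "real^'m::{finite,wellorder} \<Rightarrow> real" and g :: "real^'m::_ \<Rightarrow> real^'m::_"
  assumes S: "S \<in> sets lebesgue"
    and der: "\<And>x. x \<in> S \<Longrightarrow> (g has_derivative g' x) (at x within S)"
    and inj: "inj_on g S"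
    and 1: "set_integrable lborel S (\<lambda>x. \<bar>det (matrix (g' x))\<bar> * f (g x))"
    and 2: "set_integrable lborel (g ` S) f"
  shows "(LINT x:S|lborel. \<bar>det (matrix (g' x))\<bar> * f (g x)) = (LINT y:g ` S|lborel. f y)"
proof -
  \<comment> \<open>Absolute integrability refers to the completion of
    \<open>lborel\<close>.\<close>
  have a: "h absolutely_integrable_on T" if "set_integrable lborel T h" for h :: "real^'m::{finite,wellorder} \<Rightarrow> real" and T
    using that integrable_completion[of "\<lambda>x. indicator T x *\<^sub>R h x" lborel]
    by (auto simp: set_integrable_def borel_measurable_integrable)
  have "(\<lambda>x. \<bar>det (matrix (g' x))\<bar> *\<^sub>R vec (f(g x)) :: real ^ 1) absolutely_integrable_on S \<and>
           integral S (\<lambda>x. \<bar>det (matrix (g' x))\<bar> *\<^sub>R vec (f(g x))) = (vec b :: real ^ 1)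
         \<longleftrightarrow> (\<lambda>x. vec (f x) :: real ^ 1) absolutely_integrable_on (g ` S) \<and>
           integral (g ` S) (\<lambda>x. vec (f x)) = (vec b :: real ^ 1)" for b
    by (intro has_absolute_integral_change_of_variables assms)
  then have "(\<lambda>x. \<bar>det (matrix (g' x))\<bar> * f (g x)) absolutely_integrable_on S \<and>
           integral S (\<lambda>x. \<bar>det (matrix (g' x))\<bar> * f (g x)) = b
         \<longleftrightarrow> f absolutely_integrable_on (g ` S) \<and> integral (g ` S) f = b" for b
    by (simp add: absolutely_integrable_on_1_iff integral_on_1_eq)
  then have "integral S (\<lambda>x. \<bar>det (matrix (g' x))\<bar> * f (g x)) = integral (g ` S) f"
    using a[OF 2] by blast
  then show ?thesis
    using set_borel_integral_eq_integral(2)[OF 1] set_borel_integral_eq_integral(2)[OF 2] by simp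
qed

text \<open>The determinant is the complex one: \<open>matrix\<close> evaluates \<open>L\<close> on
  the two vectors \<open>axis j 1\<close>, which determine a complex-linear map. Its squared modulus
  is the determinant of \<open>L\<close> as a real map.\<close>

definition jac :: "(complex^2 \<Rightarrow> complex^2) \<Rightarrow> real" where
  "jac L = (cmod (det (matrix L)))\<^sup>2"

text \<open>By complex linearity the second and fourth real columns are \<i> times the first and
  third. Hence both sides are polynomials in the real and imaginary parts of the four complex
  entries.\<close>

lemma det_real4_conjugate:
  assumes L: "linear L" and cL: "\<And>c v. L (c *s v) = c *s L v"
  shows "det (matrix (\<lambda>y. to_real4 (L (of_real4 y)))) = jac L"
proof -
  define a b c d where "a = L (axis 1 1) $ 1" "b = L (axis 1 1) $ 2" "c = L (axis 2 1) $ 1" "d = L (axis 2 1) $ 2"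
  note ab = this
  have eq: "of_real4 (axis 1 1) = axis 1 1" "of_real4 (axis 2 1) = \<i> *s axis 1 1"
    "of_real4 (axis 3 1) = axis 2 1" "of_real4 (axis 4 1) = \<i> *s axis 2 1"
    by (simp_all add: vec_eq_iff forall_2 axis_def complex_eq_iff)
  show ?thesis
    unfolding det_4 jac_def det_2 cmod_power2
    by (simp add: matrix_def eq cL ab[symmetric]) algebra
qed

lemma lborel_integral_holomorphic_change_of_variables:
  fixes g :: "complex^2 \<Rightarrow> real"
  assumes U: "open U"
    and der: "\<And>x. x \<in> U \<Longrightarrow> (\<phi> has_derivative \<phi>' x) (at x)"
    and lin: "\<And>x c v. x \<in> U \<Longrightarrow> \<phi>' x (c *s v) = c *s \<phi>' x v"
    and inj: "inj_on \<phi> U"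
    and 1: "set_integrable lborel U (\<lambda>x. jac (\<phi>' x) * g (\<phi> x))"
    and 2: "set_integrable lborel (\<phi> ` U) g"
  shows "(LINT x:U|lborel. jac (\<phi>' x) * g (\<phi> x)) = (LINT y:\<phi> ` U|lborel. g y)"
proof -
  let ?S = "to_real4 ` U" and ?f = "\<lambda>y. g (of_real4 y)" and ?g = "\<lambda>y. to_real4 (\<phi> (of_real4 y))"
  let ?g' = "\<lambda>y v. to_real4 (\<phi>' (of_real4 y) (of_real4 v))"
  have bl: "bounded_linear to_real4" "bounded_linear of_real4"
    by (simp_all add: linear_to_real4 linear_of_real4 linear_conv_bounded_linear[symmetric])
  have S: "?S = of_real4 -` U"
    by (auto simp: image_iff) (metis to_real4_of_real4)
  have "open ?S"
    unfolding S by (intro open_vimage U linear_continuous_on bl)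
  \<comment> \<open>The absolute value drops out because \<open>jac\<close> is a square.\<close>
  have J: "\<bar>det (matrix (?g' y))\<bar> = jac (\<phi>' (of_real4 y))" if "y \<in> ?S" for y
  proof -
    have "of_real4 y \<in> U" using that by auto
    then show ?thesis
      using det_real4_conjugate[of "\<phi>' (of_real4 y)"] der[THEN has_derivative_linear] lin
      by (simp add: jac_def)
  qed
  have im: "?g ` ?S = to_real4 ` (\<phi> ` U)" by (force simp: image_iff)
  have "(LINT y:?S|lborel. \<bar>det (matrix (?g' y))\<bar> * ?f (?g y)) = (LINT y:?g ` ?S|lborel. ?f y)"
  proof (rule lborel_integral_change_of_variables_1)
    show "?S \<in> sets lebesgue" using \<open>open ?S\<close> by auto
    show "(?g has_derivative ?g' y) (at y within ?S)" if "y \<in> ?S" for y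
    proof -
      have "of_real4 y \<in> U" using that by auto
      then have "(\<phi> has_derivative \<phi>' (of_real4 y)) (at (of_real4 y))" by (rule der)
      then have "((\<lambda>y. \<phi> (of_real4 y)) has_derivative (\<lambda>v. \<phi>' (of_real4 y) (of_real4 v))) (at y)"
        by (intro has_derivative_compose[OF bounded_linear_imp_has_derivative[OF bl(2)]])
      then show ?thesis
        by (rule has_derivative_at_withinI[OF bounded_linear.has_derivative[OF bl(1)]])
    qed
    show "inj_on ?g ?S"
      using inj by (auto simp: inj_on_def) (metis of_real4_to_real4)
    show "set_integrable lborel ?S (\<lambda>y. \<bar>det (matrix (?g' y))\<bar> * ?f (?g y))"
      using lborel_integral_of_real4(2)[OF 1]
      by (rule set_integrable_cong[THEN iffD1, rotated 3]) (auto simp: J)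
    show "set_integrable lborel (?g ` ?S) ?f"
      unfolding im by (rule lborel_integral_of_real4(2)[OF 2])
  qed
  moreover have "(LINT y:?S|lborel. \<bar>det (matrix (?g' y))\<bar> * ?f (?g y)) =
      (LINT y:?S|lborel. jac (\<phi>' (of_real4 y)) * g (\<phi> (of_real4 y)))"
    unfolding set_lebesgue_integral_def
    by (intro Bochner_Integration.integral_cong) (auto simp: J indicator_def)
  ultimately show ?thesis
    unfolding im lborel_integral_of_real4(1)[OF 2] lborel_integral_of_real4(1)[OF 1] by simp
qed

section \<open>Alternating 2-forms on the real vector space C^2\<close>

abbreviation "e1 \<equiv> axis 1 1 :: complex^2"
abbreviation "e2 \<equiv> axis 1 \<i> :: complex^2"
abbreviation "e3 \<equiv> axis 2 1 :: complex^2"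
abbreviation "e4 \<equiv> axis 2 \<i> :: complex^2"

lemma complex2_expansion:
  "(x::complex^2) = Re (x$1) *\<^sub>R e1 + Im (x$1) *\<^sub>R e2 + Re (x$2) *\<^sub>R e3 + Im (x$2) *\<^sub>R e4"
  by (simp add: vec_eq_iff forall_2 axis_def complex_eq_iff)

text \<open>The factors are the six 2x2 minors of the matrix with rows \<open>u\<close> and
  \<open>v\<close>. Thus identities between forms become polynomial identities in six
  components.\<close>

lemma alternating_bilinear_expansion:
  fixes F :: "complex^2 \<Rightarrow> complex^2 \<Rightarrow> real"
  assumes "bilinear F" and alt: "\<And>u v. F u v = - F v u"
  shows "F u v = F e1 e2 * (Re (u$1) * Im (v$1) - Im (u$1) * Re (v$1))
    + F e1 e3 * (Re (u$1) * Re (v$2) - Re (u$2) * Re (v$1))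
    + F e1 e4 * (Re (u$1) * Im (v$2) - Im (u$2) * Re (v$1))
    + F e2 e3 * (Im (u$1) * Re (v$2) - Re (u$2) * Im (v$1))
    + F e2 e4 * (Im (u$1) * Im (v$2) - Im (u$2) * Im (v$1))
    + F e3 e4 * (Re (u$2) * Im (v$2) - Im (u$2) * Re (v$2))"
proof -
  have s: "F e1 e1 = 0" "F e2 e2 = 0" "F e3 e3 = 0" "F e4 e4 = 0"
    using alt[of e1 e1] alt[of e2 e2] alt[of e3 e3] alt[of e4 e4] by auto
  show ?thesis
    apply (subst complex2_expansion[of u])
    apply (subst complex2_expansion[of v])
    apply (simp only: bilinear_ladd[OF assms(1)] bilinear_radd[OF assms(1)] bilinear_lmul[OF assms(1)] bilinear_rmul[OF assms(1)] s
       alt[of e2 e1] alt[of e3 e1] alt[of e4 e1] alt[of e3 e2] alt[of e4 e2] alt[of e4 e3])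
    apply (simp add: algebra_simps)
    done
qed

text \<open>A form of top degree pulls back with the real determinant, which is \<open>jac L\<close>
  for complex-linear \<open>L\<close>. The proof expands everything in real components and checks a
  polynomial identity. The ignored arguments \<open>_\<close> let \<open>wedge\<close>, which
  expects forms on charts, act on forms at a single point.\<close>

lemma density_wedge_pullback:
  fixes F G :: "complex^2 \<Rightarrow> complex^2 \<Rightarrow> real"
  assumes F: "bilinear F" "\<And>u v. F u v = - F v u" and G: "bilinear G" "\<And>u v. G u v = - G v u"
    and L: "linear L" and cL: "\<And>c v. L (c *s v) = c *s L v"
  shows "density (wedge (\<lambda>_ _ u v. F (L u) (L v)) (\<lambda>_ _ u v. G (L u) (L v))) c x =
    jac L * density (wedge (\<lambda>_ _. F) (\<lambda>_ _. G)) c x"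
proof -
  define a b c d where "a = L e1 $ 1" "b = L e1 $ 2" "c = L e3 $ 1" "d = L e3 $ 2"
  note ab = this
  \<comment> \<open>So \<open>L\<close> is given by its values on \<open>e1\<close> and
    \<open>e3\<close>, that is, by \<open>a\<close>, \<open>b\<close>, \<open>c\<close>,
    \<open>d\<close>.\<close>
  have e: "e2 = \<i> *s e1" "e4 = \<i> *s e3"
    by (simp_all add: vec_eq_iff forall_2 axis_def)
  have L2: "L e2 = \<i> *s L e1" "L e4 = \<i> *s L e3" by (simp_all only: e cL)
  note Fx = alternating_bilinear_expansion[OF F]
  note Gx = alternating_bilinear_expansion[OF G]
  define ar ai br bi cr ci dr di where "ar = Re a" "ai = Im a" "br = Re b" "bi = Im b" "cr = Re c" "ci = Im c" "dr = Re d" "di = Im d"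
  note rr = this
  have j: "jac L = (ar * dr - ai * di - (cr * br - ci * bi))\<^sup>2 + (ar * di + ai * dr - (cr * bi + ci * br))\<^sup>2"
    by (simp add: jac_def det_2 matrix_def cmod_power2 ab[symmetric] rr)
  show ?thesis
    unfolding density_def wedge_def j Fx[of "L _"] Gx[of "L _"] L2
    apply (simp only: vector_smult_component ab[symmetric] complex_i_mult_minus Re_i_times Im_i_times rr[symmetric])
    apply algebra
    done
qed

section \<open>Calculus of continuously differentiable functions\<close>

lemma has_derivative_cong_open:
  assumes "open S" "x \<in> S" "\<And>y. y \<in> S \<Longrightarrow> f y = g y"
  shows "(f has_derivative D) (at x) \<longleftrightarrow> (g has_derivative D) (at x)"
  using assms has_derivative_transform_within_open[of f D x UNIV S g]
    has_derivative_transform_within_open[of g D x UNIV S f] by (metis (no_types, lifting))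

lemma frechet_derivative_cong_open:
  assumes "open S" "x \<in> S" "\<And>y. y \<in> S \<Longrightarrow> f y = g y"
  shows "frechet_derivative f (at x) = frechet_derivative g (at x)"
  unfolding frechet_derivative_def using has_derivative_cong_open[OF assms] by simp

lemma Ck_on_cong:
  assumes "open S" "\<And>y. y \<in> S \<Longrightarrow> f y = g y" "Ck_on k S f"
  shows "Ck_on k S g"
  using assms(2,3)
proof (induction k arbitrary: f g)
  case 0
  then show ?case using continuous_on_cong[of S S f g] by simp
next
  case (Suc k)
  have "g differentiable (at x)" if "x \<in> S" for x
    using Suc.prems that has_derivative_cong_open[OF assms(1) that, of f g]
    unfolding differentiable_def by (metis Ck_on.simps(2) differentiable_def)
  moreover have "Ck_on k S (\<lambda>x. frechet_derivative g (at x) v)" for v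
  proof (rule Suc.IH)
    show "Ck_on k S (\<lambda>x. frechet_derivative f (at x) v)" using Suc.prems by simp
    show "frechet_derivative f (at x) v = frechet_derivative g (at x) v" if "x \<in> S" for x
      using frechet_derivative_cong_open[OF assms(1) that Suc.prems(1)] by simp
  qed
  ultimately show ?case by simp
qed

lemma Ck_on_0: "Ck_on k S (\<lambda>x. 0)"
  by (induction k) (simp_all add: frechet_derivative_const)

text \<open>With the factor \<open>c\<close>, one induction covers sums, differences and scalar
  multiples.\<close>

lemma Ck_on_scaled_add:
  fixes f g :: "'b::euclidean_space \<Rightarrow> real"
  assumes "open S" "Ck_on k S f" "Ck_on k S g"
  shows "Ck_on k S (\<lambda>x. f x + c * g x)"
  using assms(2,3)
proof (induction k arbitrary: f g)
  case 0
  then show ?case by (auto intro!: continuous_intros)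
next
  case (Suc k)
  have D: "((\<lambda>x. f x + c * g x) has_derivative
      (\<lambda>v. frechet_derivative f (at x) v + c * frechet_derivative g (at x) v)) (at x)" if "x \<in> S" for x
    using Suc.prems that
    by (auto intro!: derivative_eq_intros simp: frechet_derivative_works[symmetric])
  have "Ck_on k S (\<lambda>x. frechet_derivative (\<lambda>x. f x + c * g x) (at x) v)" for v
  proof (rule Ck_on_cong[OF assms(1)])
    show "Ck_on k S (\<lambda>x. frechet_derivative f (at x) v + c * frechet_derivative g (at x) v)"
      using Suc by simp
    show "frechet_derivative f (at x) v + c * frechet_derivative g (at x) v =
        frechet_derivative (\<lambda>x. f x + c * g x) (at x) v" if "x \<in> S" for x
      using frechet_derivative_at[OF D[OF that]] by (rule fun_cong)
  qed
  then show ?case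
    using D by (auto simp: differentiable_def)
qed

lemma frechet_derivative_scaled_add:
  fixes f g :: "'b::euclidean_space \<Rightarrow> real"
  assumes "f differentiable (at x)" "g differentiable (at x)"
  shows "frechet_derivative (\<lambda>x. f x + c * g x) (at x) v =
    frechet_derivative f (at x) v + c * frechet_derivative g (at x) v"
proof -
  have "((\<lambda>x. f x + c * g x) has_derivative
      (\<lambda>v. frechet_derivative f (at x) v + c * frechet_derivative g (at x) v)) (at x)"
    using assms
    by (auto intro!: derivative_eq_intros simp: frechet_derivative_works[symmetric])
  from frechet_derivative_at[OF this] show ?thesis by metis
qed

lemma C1_onI:
  assumes "\<And>x. x \<in> S \<Longrightarrow> (f has_derivative D x) (at x)" "\<And>v. continuous_on S (\<lambda>x. D x v)"
  shows "Ck_on (Suc 0) S f"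
proof -
  have "continuous_on S (\<lambda>x. frechet_derivative f (at x) v)" for v
    using assms(2)[of v] by (rule continuous_on_eq) (simp add: frechet_derivative_at[OF assms(1), symmetric])
  then show ?thesis using assms(1) by (auto simp: differentiable_def)
qed

lemma C1_onD:
  assumes "Ck_on (Suc 0) S f" "x \<in> S"
  shows "(f has_derivative frechet_derivative f (at x)) (at x)"
  using assms by (simp add: frechet_derivative_works[symmetric])

lemma C1_on_continuous:
  assumes "Ck_on (Suc 0) S f"
  shows "continuous_on S f"
  using assms by (auto intro!: continuous_at_imp_continuous_on differentiable_imp_continuous_within)

lemma C1_on_mult:
  fixes f g :: "'b::euclidean_space \<Rightarrow> real"
  assumes "Ck_on (Suc 0) S f" "Ck_on (Suc 0) S g"
  shows "Ck_on (Suc 0) S (\<lambda>x. f x * g x)"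
proof (rule C1_onI)
  show "((\<lambda>x. f x * g x) has_derivative
     (\<lambda>v. f x * frechet_derivative g (at x) v + frechet_derivative f (at x) v * g x)) (at x)" if "x \<in> S" for x
    by (rule has_derivative_mult C1_onD assms that)+
  show "continuous_on S (\<lambda>x. f x * frechet_derivative g (at x) v + frechet_derivative f (at x) v * g x)" for v
    using assms C1_on_continuous[OF assms(1)] C1_on_continuous[OF assms(2)]
    by (auto intro!: continuous_intros)
qed

lemma C1_on_divide:
  fixes f g :: "'b::euclidean_space \<Rightarrow> real"
  assumes "Ck_on (Suc 0) S f" "Ck_on (Suc 0) S g" and nz: "\<And>x. x \<in> S \<Longrightarrow> g x \<noteq> 0"
  shows "Ck_on (Suc 0) S (\<lambda>x. f x / g x)"
proof (rule C1_onI)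
  show "((\<lambda>x. f x / g x) has_derivative
     (\<lambda>v. (frechet_derivative f (at x) v * g x - f x * frechet_derivative g (at x) v) / (g x * g x))) (at x)"
    if "x \<in> S" for x
    by (rule has_derivative_divide' C1_onD assms that)+
  show "continuous_on S (\<lambda>x. (frechet_derivative f (at x) v * g x - f x * frechet_derivative g (at x) v) / (g x * g x))" for v
    using assms C1_on_continuous[OF assms(1)] C1_on_continuous[OF assms(2)]
    by (auto intro!: continuous_intros)
qed

lemma Ck_on_sum:
  fixes f :: "'i \<Rightarrow> 'b::euclidean_space \<Rightarrow> real"
  assumes "open S" "finite I" "\<And>i. i \<in> I \<Longrightarrow> Ck_on k S (f i)"
  shows "Ck_on k S (\<lambda>x. \<Sum>i\<in>I. c i * f i x)"
  using assms(2,3)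
proof (induction rule: finite_induct)
  case (insert i I)
  then show ?case
    using Ck_on_scaled_add[OF assms(1), of k "\<lambda>x. \<Sum>i\<in>I. c i * f i x" "f i" "c i"] by (simp add: add.commute)
qed (simp add: Ck_on_0)

lemma C1_on_Un:
  assumes "open S" "open T" "Ck_on (Suc 0) S f" "Ck_on (Suc 0) T f"
  shows "Ck_on (Suc 0) (S \<union> T) f"
  using assms by (auto intro!: continuous_on_open_Un)

section \<open>Integrals of compactly supported functions\<close>

text \<open>The extensions of \<open>f\<close> by zero off \<open>U\<close> and off \<open>K\<close>
  agree, and the latter is integrable by continuity on a compact set.\<close>

lemma set_integrable_compact_support:
  fixes f :: "'b::euclidean_space \<Rightarrow> real"
  assumes "continuous_on U f" "compact K" "K \<subseteq> U" "\<And>x. x \<in> U - K \<Longrightarrow> f x = 0"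
  shows "set_integrable lborel U f"
proof -
  have "set_integrable lborel K f"
    unfolding set_integrable_def
    using assms by (intro borel_integrable_compact) (auto intro: continuous_on_subset)
  moreover have "indicator U x *\<^sub>R f x = indicator K x *\<^sub>R f x" for x
    using assms(3,4) by (auto simp: indicator_def)
  ultimately show ?thesis unfolding set_integrable_def by (simp only:)
qed

text \<open>Translation invariance makes the integrals of the difference quotients vanish.\<close>

lemma integral_directional_derivative_eq_0:
  fixes h :: "'b::euclidean_space \<Rightarrow> real"
  assumes D: "\<And>x. (h has_derivative D x) (at x)" and cont: "continuous_on UNIV (\<lambda>x. D x v)"
    and K: "compact K" "\<And>x. x \<notin> K \<Longrightarrow> h x = 0"
  shows "(LINT x|lborel. D x v) = 0"
proof -
  \<comment> \<open>The complement of \<open>K\<close> is open, so \<open>h\<close> vanishes near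
    every point outside \<open>K\<close>.\<close>
  have D0: "D x v = 0" if "x \<notin> K" for x
  proof -
    have "(h has_derivative D x) (at x) \<longleftrightarrow> ((\<lambda>_. 0) has_derivative D x) (at x)"
      using K that by (intro has_derivative_cong_open[of "-K"]) (auto intro: compact_imp_closed)
    then have "((\<lambda>_. 0::real) has_derivative D x) (at x)" using D by blast
    then have "D x = (\<lambda>_. 0)" using has_derivative_unique has_derivative_const by blast
    then show ?thesis by simp
  qed
  have hc: "continuous_on UNIV h"
    using D by (meson continuous_at_imp_continuous_on has_derivative_continuous)
  have hi: "integrable lborel h"
    using set_integrable_compact_support[OF hc K(1)] K(2) by (simp add: set_integrable_def)
  have "bounded ((\<lambda>x. D x v) ` K)"
    by (intro compact_imp_bounded compact_continuous_image continuous_on_subset[OF cont] K(1)) simp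
  then obtain B where "B > 0" "\<forall>y\<in>(\<lambda>x. D x v) ` K. norm y \<le> B"
    unfolding bounded_pos by blast
  then have B: "\<And>x. x \<in> K \<Longrightarrow> norm (D x v) \<le> B" and B0: "B \<ge> 0" by auto
  have B': "\<bar>D x v\<bar> \<le> B" for x using B[of x] D0[of x] B0 by (cases "x \<in> K") auto
  obtain R where R: "\<And>x. x \<in> K \<Longrightarrow> norm x \<le> R"
    using compact_imp_bounded[OF K(1)] unfolding bounded_iff by auto
  \<comment> \<open>Positive step sizes tending to 0. The bound \<open>t n \<le> 1\<close> keeps all
    shifts within distance \<open>norm v\<close>.\<close>
  define t where "t = (\<lambda>n::nat. inverse (real (Suc n)))"
  have t: "t n > 0" "t n \<le> 1" for n by (auto simp: t_def field_simps)
  define f where "f = (\<lambda>n x. (h (x + t n *\<^sub>R v) - h x) / t n)"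
  \<comment> \<open>The dominating function. Outside this ball both \<open>x\<close> and its shift
    lie outside \<open>K\<close>, so the quotient is 0. Inside, the mean value theorem bounds the
    quotient by \<open>B\<close>.\<close>
  define w where "w = (\<lambda>x::'b. indicator (cball 0 (R + norm v)) x *\<^sub>R B)"
  have tr: "integrable lborel (\<lambda>x. h (x + a))" "(LINT x|lborel. h (x + a)) = (LINT x|lborel. h x)" for a
  proof -
    have eq: "lborel = distr lborel borel (\<lambda>x::'b. a + x)" by (rule lborel_distr_plus[symmetric])
    have m: "h \<in> borel_measurable borel" using hi by auto
    show "(LINT x|lborel. h (x + a)) = (LINT x|lborel. h x)"
      by (subst (2) eq, subst integral_distr) (auto simp: m add.commute)
    have "integrable (distr lborel borel (\<lambda>x::'b. a + x)) h" using hi eq by simp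
    then show "integrable lborel (\<lambda>x. h (x + a))"
      by (subst (asm) integrable_distr_eq) (auto simp: m add.commute)
  qed
  have line: "((\<lambda>s. x + s *\<^sub>R v) has_derivative (\<lambda>s. s *\<^sub>R v)) (at s)" for x s
    by (auto intro!: derivative_eq_intros)
  have comp: "((\<lambda>s. h (x + s *\<^sub>R v)) has_derivative (\<lambda>s'. D (x + s *\<^sub>R v) (s' *\<^sub>R v))) (at s)" for x s
    by (rule has_derivative_compose[OF line D])
  have fi: "(LINT x|lborel. f n x) = 0" for n
    using hi tr by (simp add: f_def)
  have "(\<lambda>n. LINT x|lborel. f n x) \<longlonglongrightarrow> (LINT x|lborel. D x v)"
  proof (rule integral_dominated_convergence)
    show "(\<lambda>x. D x v) \<in> borel_measurable lborel"
      using borel_measurable_continuous_onI[OF cont] by simp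
    show "f n \<in> borel_measurable lborel" for n
      unfolding f_def using hi tr by (auto intro!: borel_measurable_integrable)
    show "integrable lborel w"
      unfolding w_def by (intro borel_integrable_compact) auto
    show "AE x in lborel. (\<lambda>n. f n x) \<longlonglongrightarrow> D x v"
    proof (rule AE_I2)
      fix x
      have "((\<lambda>s. h (x + s *\<^sub>R v)) has_derivative (\<lambda>s. D x (s *\<^sub>R v))) (at 0)"
        using comp[of x 0] by simp
      then have "((\<lambda>s. h (x + s *\<^sub>R v)) has_field_derivative D x v) (at 0)"
        using linear_cmul[OF has_derivative_linear[OF D[of x]]]
        by (simp add: has_field_derivative_def mult.commute[of _ "D x v"] fun_eq_iff mult_commute_abs)
      then have "((\<lambda>s. (h (x + s *\<^sub>R v) - h x) / s) \<longlongrightarrow> D x v) (at 0)"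
        by (simp add: DERIV_def)
      moreover have "filterlim t (at 0) sequentially"
        unfolding filterlim_at using t LIMSEQ_inverse_real_of_nat
        by (auto simp: t_def intro!: always_eventually)
      ultimately show "(\<lambda>n. f n x) \<longlonglongrightarrow> D x v"
        unfolding f_def by (rule filterlim_compose)
    qed
    show "AE x in lborel. norm (f n x) \<le> w x" for n
    proof (rule AE_I2)
      fix x
      show "norm (f n x) \<le> w x"
      proof (cases "x \<in> cball 0 (R + norm v)")
        case True
        have "\<exists>s\<in>{0<..<t n}. h (x + t n *\<^sub>R v) - h (x + 0 *\<^sub>R v) = (\<lambda>s'. D (x + s *\<^sub>R v) (s' *\<^sub>R v)) (t n - 0)"
          by (intro mvt_simple comp has_derivative_at_withinI t)
        then obtain s where "h (x + t n *\<^sub>R v) - h x = t n * D (x + s *\<^sub>R v) v"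
          using linear_cmul[OF has_derivative_linear[OF D]] by auto
        then have "f n x = D (x + s *\<^sub>R v) v" using t[of n] by (simp add: f_def)
        then show ?thesis using True B' by (simp add: w_def)
      next
        case False
        have 1: "norm x > R + norm v" using False by simp
        have "norm (t n *\<^sub>R v) \<le> norm v" using t[of n] by (simp add: mult_left_le_one_le)
        then have "norm (x + t n *\<^sub>R v) > R"
          using 1 norm_triangle_ineq4[of "x + t n *\<^sub>R v" "t n *\<^sub>R v"] by simp
        then have "h (x + t n *\<^sub>R v) = 0" using K(2) R by force
        moreover have "norm x > R" using 1 norm_ge_zero[of v] by linarith
        then have "h x = 0" using K(2) R by force
        ultimately show ?thesis using B0 by (simp add: f_def w_def)
      qed
    qed
  qed
  then show ?thesis unfolding fi by (simp add: LIMSEQ_const_iff)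
qed

text \<open>The extension of \<open>h\<close> by zero is C^1 on the whole space: \<open>U\<close>
  and the complement of \<open>K\<close> are open and cover it, and on the second set the extension
  is 0.\<close>

lemma set_integral_frechet_derivative_eq_0:
  fixes h :: "'b::euclidean_space \<Rightarrow> real"
  assumes U: "open U" and h: "Ck_on (Suc 0) U h" and K: "compact K" "K \<subseteq> U" "\<And>x. x \<in> U - K \<Longrightarrow> h x = 0"
  shows "set_integrable lborel U (\<lambda>x. frechet_derivative h (at x) v)"
    and "(LINT x:U|lborel. frechet_derivative h (at x) v) = 0"
proof -
  define h0 where "h0 = (\<lambda>x. if x \<in> U then h x else 0)"
  define D where "D = (\<lambda>x v. if x \<in> U then frechet_derivative h (at x) v else 0)"
  have oK: "open (-K)" using K(1) by (auto intro: compact_imp_closed)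
  have z: "frechet_derivative h (at x) v = 0" if "x \<in> U - K" for x v
  proof -
    have "open (U - K)" by (rule open_Diff[OF U compact_imp_closed[OF K(1)]])
    then have "frechet_derivative h (at x) = frechet_derivative (\<lambda>_. 0) (at x)"
      using that K(3) by (rule frechet_derivative_cong_open)
    then show ?thesis by (simp add: frechet_derivative_const)
  qed
  have hd: "(h0 has_derivative D x) (at x)" for x
  proof (cases "x \<in> U")
    case True
    then have "D x = frechet_derivative h (at x)" by (simp add: D_def)
    moreover have "(h0 has_derivative frechet_derivative h (at x)) (at x)"
      by (rule has_derivative_cong_open[THEN iffD1, OF U True _ C1_onD[OF h True]]) (simp add: h0_def)
    ultimately show ?thesis by simp
  next
    case False
    then have "D x = (\<lambda>_. 0)" by (simp add: D_def)
    moreover have "(h0 has_derivative (\<lambda>_. 0)) (at x)"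
    proof (rule has_derivative_cong_open[THEN iffD2, OF oK])
      show "h0 y = 0" if "y \<in> -K" for y using that K by (auto simp: h0_def)
    qed (use False K in auto)
    ultimately show ?thesis by simp
  qed
  have "continuous_on (U \<union> -K) (\<lambda>x. D x v)"
  proof (rule continuous_on_open_Un)
    show "continuous_on U (\<lambda>x. D x v)"
      by (rule continuous_on_eq[of U "\<lambda>x. frechet_derivative h (at x) v"]) (use h in \<open>auto simp: D_def\<close>)
    show "continuous_on (-K) (\<lambda>x. D x v)"
      by (rule continuous_on_eq[of _ "\<lambda>_. 0"]) (auto simp: D_def z)
  qed (use U oK in auto)
  moreover have "U \<union> -K = UNIV" using K by auto
  ultimately have "continuous_on UNIV (\<lambda>x. D x v)" by simp
  then have "(LINT x|lborel. D x v) = 0"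
    by (rule integral_directional_derivative_eq_0[OF hd _ K(1)]) (use K(3) in \<open>auto simp: h0_def\<close>)
  moreover have "indicator U x *\<^sub>R frechet_derivative h (at x) v = D x v" for x
    by (simp add: D_def)
  ultimately show "(LINT x:U|lborel. frechet_derivative h (at x) v) = 0"
    unfolding set_lebesgue_integral_def by (simp only:)
  show "set_integrable lborel U (\<lambda>x. frechet_derivative h (at x) v)"
  proof (rule set_integrable_compact_support[OF _ K(1,2)])
    show "continuous_on U (\<lambda>x. frechet_derivative h (at x) v)" using h by simp
  qed (rule z)
qed

text \<open>The second term of the Leibniz rule
  \<open>d (f \<beta>) = f d \<beta> + d f \<and> \<beta>\<close>.\<close>

definition d0_wedge :: "('a \<Rightarrow> real) \<Rightarrow> 'a form1 \<Rightarrow> 'a form2" where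
  "d0_wedge f \<beta> c x u v =
     frechet_derivative (f \<circ> chart_inv c) (at x) u * \<beta> c x v
     - frechet_derivative (f \<circ> chart_inv c) (at x) v * \<beta> c x u"

definition mult2 :: "('a \<Rightarrow> real) \<Rightarrow> 'a form2 \<Rightarrow> 'a form2" where
  "mult2 f F c x u v = f (chart_inv c x) * F c x u v"

definition add2 :: "'a form2 \<Rightarrow> 'a form2 \<Rightarrow> 'a form2" where
  "add2 F G c x u v = F c x u v + G c x u v"

text \<open>The integrand is \<open>d (f \<beta> \<and> G)\<close>, since \<open>G\<close> is closed.\<close>

lemma stokes_in_chart:
  assumes U: "U = chart_image c" "open U"
    and f: "Ck_on (Suc 0) U (f \<circ> chart_inv c)"
    and K: "compact K" "K \<subseteq> U" "\<And>x. x \<in> U - K \<Longrightarrow> f (chart_inv c x) = 0"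
    and \<beta>: "\<And>u. Ck_on (Suc 0) U (\<lambda>x. \<beta> c x u)"
    and G: "\<And>u v. Ck_on (Suc 0) U (\<lambda>x. G c x u v)"
    and closed: "\<And>x u v w. x \<in> U \<Longrightarrow> 
        frechet_derivative (\<lambda>y. G c y v w) (at x) u
        - frechet_derivative (\<lambda>y. G c y u w) (at x) v
        + frechet_derivative (\<lambda>y. G c y u v) (at x) w = 0"
  shows "(LINT x:U|lborel. density (wedge (add2 (mult2 f (d1 \<beta>)) (d0_wedge f \<beta>)) G) c x) = 0"
proof -
  define s where "s = f \<circ> chart_inv c"
  \<comment> \<open>Let \<theta> be the 3-form \<open>f \<beta> \<and> G\<close>. The functions
    \<open>h1\<close>, \<open>h2\<close>, \<open>h3\<close>, \<open>h4\<close> are its components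
    \<theta>(e2,e3,e4), -\<theta>(e1,e3,e4), \<theta>(e1,e2,e4), -\<theta>(e1,e2,e3). With these
    signs, the sum of the derivatives of \<open>h1\<close> along \<open>e1\<close>, ...,
    \<open>h4\<close> along \<open>e4\<close> is the density of d \<theta>.\<close>
  define h1 where "h1 = (\<lambda>x. s x * (\<beta> c x e2 * G c x e3 e4 + (-1) * (\<beta> c x e3 * G c x e2 e4) + 1 * (\<beta> c x e4 * G c x e2 e3)))"
  define h2 where "h2 = (\<lambda>x. s x * (\<beta> c x e3 * G c x e1 e4 + (-1) * (\<beta> c x e1 * G c x e3 e4) + (-1) * (\<beta> c x e4 * G c x e1 e3)))"
  define h3 where "h3 = (\<lambda>x. s x * (\<beta> c x e1 * G c x e2 e4 + (-1) * (\<beta> c x e2 * G c x e1 e4) + 1 * (\<beta> c x e4 * G c x e1 e2)))"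
  define h4 where "h4 = (\<lambda>x. s x * (\<beta> c x e2 * G c x e1 e3 + (-1) * (\<beta> c x e1 * G c x e2 e3) + (-1) * (\<beta> c x e3 * G c x e1 e2)))"
  have s: "Ck_on (Suc 0) U s" using f by (simp add: s_def)
  have C: "Ck_on (Suc 0) U h1" "Ck_on (Suc 0) U h2" "Ck_on (Suc 0) U h3" "Ck_on (Suc 0) U h4"
    unfolding h1_def h2_def h3_def h4_def by (intro C1_on_mult Ck_on_scaled_add U(2) s \<beta> G)+
  have z: "h1 x = 0" "h2 x = 0" "h3 x = 0" "h4 x = 0" if "x \<in> U - K" for x
    using K(3)[OF that] by (auto simp: h1_def h2_def h3_def h4_def s_def)
  note I1 = set_integral_frechet_derivative_eq_0[OF U(2) C(1) K(1,2) z(1), of e1]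
  note I2 = set_integral_frechet_derivative_eq_0[OF U(2) C(2) K(1,2) z(2), of e2]
  note I3 = set_integral_frechet_derivative_eq_0[OF U(2) C(3) K(1,2) z(3), of e3]
  note I4 = set_integral_frechet_derivative_eq_0[OF U(2) C(4) K(1,2) z(4), of e4]
  have eq: "density (wedge (add2 (mult2 f (d1 \<beta>)) (d0_wedge f \<beta>)) G) c x =
    frechet_derivative h1 (at x) e1 + frechet_derivative h2 (at x) e2
    + frechet_derivative h3 (at x) e3 + frechet_derivative h4 (at x) e4" if x: "x \<in> U" for x
  proof -
    define ds where "ds = frechet_derivative s (at x)"
    define dB where "dB = (\<lambda>u. frechet_derivative (\<lambda>x. \<beta> c x u) (at x))"
    define dG where "dG = (\<lambda>u v. frechet_derivative (\<lambda>x. G c x u v) (at x))"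
    have D: "(s has_derivative ds) (at x)" "((\<lambda>x. \<beta> c x u) has_derivative dB u) (at x)"
      "((\<lambda>x. G c x u v) has_derivative dG u v) (at x)" for u v
      unfolding ds_def dB_def dG_def by (rule C1_onD[OF _ x] s \<beta> G)+
    \<comment> \<open>All four components have this shape, so the product rule is worked out
      once.\<close>
    have T: "((\<lambda>x. s x * (\<beta> c x i * G c x p q + a * (\<beta> c x j * G c x r t) + b * (\<beta> c x k * G c x y z))) has_derivative
       (\<lambda>u. ds u * (\<beta> c x i * G c x p q + a * (\<beta> c x j * G c x r t) + b * (\<beta> c x k * G c x y z))
         + s x * ((dB i u * G c x p q + \<beta> c x i * dG p q u) + a * (dB j u * G c x r t + \<beta> c x j * dG r t u)
         + b * (dB k u * G c x y z + \<beta> c x k * dG y z u)))) (at x)" for i j k p q r t y z a b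
    proof -
      have P: "((\<lambda>x. \<beta> c x i * G c x p q) has_derivative (\<lambda>u. dB i u * G c x p q + \<beta> c x i * dG p q u)) (at x)" for i p q
        using has_derivative_mult[OF D(2)[of i] D(3)[of p q]] by (simp add: add.commute)
      show ?thesis
        using has_derivative_mult[OF D(1) has_derivative_add[OF has_derivative_add[OF P[of i p q]
          has_derivative_mult_right[OF P[of j r t], of a]] has_derivative_mult_right[OF P[of k y z], of b]]]
        by (simp only: add.commute)
    qed
    note H = T[THEN frechet_derivative_at, symmetric]
    have "dG v w u = dG u w v - dG u v w" for u v w
      using closed[OF x, of v w u] by (simp add: dG_def)
    \<comment> \<open>One instance of closedness for each triple of basis vectors. Each eliminates
      one derivative of \<open>G\<close>, after which the terms with derivatives of \<open>G\<close>
      cancel.\<close>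
    note cl = this[of e3 e4 e2] this[of e3 e4 e1] this[of e2 e4 e1] this[of e2 e3 e1]
    have dBf: "frechet_derivative (\<lambda>y. \<beta> c y u) (at x) = dB u" for u
      by (simp add: dB_def)
    have sx: "s x = f (chart_inv c x)" by (simp add: s_def)
    show ?thesis
      unfolding h1_def h2_def h3_def h4_def H density_def wedge_def add2_def mult2_def d0_wedge_def d1_def
        s_def[symmetric] ds_def[symmetric] dBf sx[symmetric]
        cl
      by (simp add: algebra_simps)
  qed
  have "(LINT x:U|lborel. density (wedge (add2 (mult2 f (d1 \<beta>)) (d0_wedge f \<beta>)) G) c x) =
    (LINT x:U|lborel. frechet_derivative h1 (at x) e1 + frechet_derivative h2 (at x) e2
    + frechet_derivative h3 (at x) e3 + frechet_derivative h4 (at x) e4)"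
    using U(2) by (intro set_lebesgue_integral_cong) (auto simp: eq)
  also have "\<dots> = 0"
    using I1 I2 I3 I4 by (simp add: set_integral_add)
  finally show ?thesis .
qed

section \<open>Charts\<close>

locale compact_complex_surface =
  fixes M :: "'a::t2_space set" and A :: "'a chart set"
  assumes complex_surface: "complex_surface M A" and compact: "compact M"
begin

lemma chart:
  assumes "c \<in> A"
  shows "openin (top_of_set M) (fst c)" "open (chart_image c)"
    "homeomorphism (fst c) (chart_image c) (snd c) (chart_inv c)" "fst c \<subseteq> M"
  using assms complex_surface unfolding complex_surface_def by auto

lemma chart_covers: "p \<in> M \<Longrightarrow> \<exists>c\<in>A. p \<in> fst c"
  using complex_surface unfolding complex_surface_def by blast

lemma chart_inv:
  assumes "c \<in> A"
  shows "x \<in> chart_image c \<Longrightarrow> chart_inv c x \<in> fst c" "x \<in> chart_image c \<Longrightarrow> chart_inv c x \<in> M"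
    "x \<in> chart_image c \<Longrightarrow> snd c (chart_inv c x) = x"
    "p \<in> fst c \<Longrightarrow> snd c p \<in> chart_image c" "p \<in> fst c \<Longrightarrow> chart_inv c (snd c p) = p"
    "continuous_on (chart_image c) (chart_inv c)" "continuous_on (fst c) (snd c)"
  using chart(3,4)[OF assms] unfolding homeomorphism_def by auto

lemma overlap_eq:
  assumes "c \<in> A"
  shows "overlap c d = {x \<in> chart_image c. chart_inv c x \<in> fst d}"
proof -
  have "x \<in> overlap c d" if "x \<in> chart_image c" "chart_inv c x \<in> fst d" for x
    unfolding overlap_def using chart_inv(1,3)[OF assms that(1)] that(2) by (metis IntI image_eqI)
  then show ?thesis using chart_inv(4,5)[OF assms] by (auto simp: overlap_def)
qed

text \<open>Chart domains are open only relative to \<open>M\<close>. The homeomorphism onto the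
  open set \<open>chart_image c\<close> turns this into openness in C^2.\<close>

lemma open_overlap:
  assumes "c \<in> A" "d \<in> A"
  shows "open (overlap c d)"
proof -
  have "openin (top_of_set (fst c)) (fst c \<inter> fst d)"
    using chart(1,4)[OF assms(1)] chart(1)[OF assms(2)]
    by (meson inf_le1 openin_Int openin_subset_trans)
  then have "openin (top_of_set (chart_image c)) (overlap c d)"
    unfolding overlap_def by (rule homeomorphism_imp_open_map[OF chart(3)[OF assms(1)]])
  then show ?thesis using chart(2)[OF assms(1)] openin_open_trans by blast
qed

lemma transition:
  assumes "c \<in> A" "d \<in> A" "x \<in> overlap c d"
  shows "transition c d x \<in> overlap d c" "transition c d x \<in> chart_image d"
    "chart_inv d (transition c d x) = chart_inv c x" "x \<in> chart_image c"
  using assms chart_inv(4,5)[OF assms(2)] chart_inv(1)[OF assms(1)]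
  by (auto simp: overlap_eq transition_def)

lemma bij_betw_transition:
  assumes "c \<in> A" "d \<in> A"
  shows "bij_betw (transition c d) (overlap c d) (overlap d c)"
proof (rule bij_betw_byWitness[where f' = "transition d c"])
  have "transition d c (transition c d x) = x" if "c \<in> A" "d \<in> A" "x \<in> overlap c d" for c d x
    using transition(3,4)[OF that] chart_inv(3)[OF that(1)] by (simp add: transition_def)
  then show "\<forall>x\<in>overlap c d. transition d c (transition c d x) = x"
    "\<forall>x\<in>overlap d c. transition c d (transition d c x) = x" using assms by blast+
qed (use transition(1)[OF assms] transition(1)[OF assms(2,1)] in blast)+

lemma transition_derivative:
  assumes "c \<in> A" "d \<in> A"
  shows has_derivative_transition:
      "x \<in> overlap c d \<Longrightarrow> (transition c d has_derivative dtransition c d x) (at x)"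
    and dtransition_scale: "x \<in> overlap c d \<Longrightarrow> dtransition c d x (a *s v) = a *s dtransition c d x v"
    and continuous_on_dtransition: "continuous_on (overlap c d) (\<lambda>x. dtransition c d x v)"
proof -
  \<comment> \<open>Holomorphy of transitions is stated for each component. The derivatives of the
    components are assembled into that of the vector-valued map.\<close>
  define D where "D = (\<lambda>x v. (\<chi> i. frechet_derivative (\<lambda>x. transition c d x $ i) (at x) v))"
  have h: "holomorphic2_on (overlap c d) (\<lambda>x. transition c d x $ i)" for i
    using assms complex_surface unfolding complex_surface_def by blast
  have hol: "smooth_on (overlap c d) (\<lambda>x. transition c d x $ i)"
    "x \<in> overlap c d \<Longrightarrow> frechet_derivative (\<lambda>x. transition c d x $ i) (at x) (a *s v) =
      a * frechet_derivative (\<lambda>x. transition c d x $ i) (at x) v" for i x a v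
    using h[of i] unfolding holomorphic2_on_def by blast+
  have C1: "Ck_on (Suc 0) (overlap c d) (\<lambda>x. transition c d x $ i)" for i
    using hol(1)[of i] unfolding smooth_on_def by blast
  have hd: "(transition c d has_derivative D x) (at x)" if "x \<in> overlap c d" for x
  proof (rule has_derivative_componentwise_within[THEN iffD2], rule ballI)
    fix b :: "complex^2" assume "b \<in> Basis"
    then obtain i b' where b: "b = axis i b'" by (auto simp: Basis_vec_def)
    show "((\<lambda>x. transition c d x \<bullet> b) has_derivative (\<lambda>v. D x v \<bullet> b)) (at x)"
      unfolding b inner_axis D_def vec_lambda_beta
      by (intro has_derivative_inner_left C1_onD[OF C1 that])
  qed
  then have eq: "dtransition c d x = D x" if "x \<in> overlap c d" for x
    unfolding dtransition_def using frechet_derivative_at that by metis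
  show "x \<in> overlap c d \<Longrightarrow> (transition c d has_derivative dtransition c d x) (at x)"
    using hd eq by simp
  show "x \<in> overlap c d \<Longrightarrow> dtransition c d x (a *s v) = a *s dtransition c d x v"
    by (simp add: eq D_def hol(2) vec_eq_iff)
  have "continuous_on (overlap c d) (\<lambda>x. D x v)"
    unfolding D_def using C1 by (intro continuous_on_vec_lambda) simp
  then show "continuous_on (overlap c d) (\<lambda>x. dtransition c d x v)"
    by (rule continuous_on_eq) (simp add: eq)
qed

lemma linear_dtransition:
  "c \<in> A \<Longrightarrow> d \<in> A \<Longrightarrow> x \<in> overlap c d \<Longrightarrow> linear (dtransition c d x)"
  using has_derivative_transition has_derivative_linear by blast

lemma continuous_on_transition:
  "c \<in> A \<Longrightarrow> d \<in> A \<Longrightarrow> continuous_on (overlap c d) (transition c d)"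
  using has_derivative_transition
  by (meson continuous_at_imp_continuous_on has_derivative_continuous)

text \<open>Continuity is local, and a chart domain is a relative neighbourhood in \<open>M\<close>
  of each of its points.\<close>

lemma continuous_on_M:
  assumes "\<And>c. c \<in> A \<Longrightarrow> continuous_on (chart_image c) (f \<circ> chart_inv c)"
  shows "continuous_on M f"
  unfolding continuous_on_eq_continuous_within
proof
  fix p assume "p \<in> M"
  then obtain c where c: "c \<in> A" "p \<in> fst c" using chart_covers by blast
  have "continuous_on (fst c) ((f \<circ> chart_inv c) \<circ> snd c)"
    using chart_inv(4)[OF c(1)]
    by (intro continuous_on_compose chart_inv(7)[OF c(1)] continuous_on_subset[OF assms[OF c(1)]]) auto
  then have "continuous_on (fst c) f"
    by (rule continuous_on_eq) (simp add: chart_inv(5)[OF c(1)])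
  then have "continuous (at p within fst c) f"
    using c(2) by (simp add: continuous_on_eq_continuous_within)
  moreover obtain T where "open T" "fst c = M \<inter> T"
    using chart(1)[OF c(1)] by (auto simp: openin_open)
  then have "at p within fst c = at p within M"
    using c(2) by (intro at_within_nhd[of p T]) auto
  ultimately show "continuous (at p within M) f" by simp
qed

lemma continuous_on_chart_inv:
  assumes "c \<in> A" "continuous_on M f"
  shows "continuous_on (chart_image c) (\<lambda>x. f (chart_inv c x))"
  by (rule continuous_on_compose2[OF assms(2) chart_inv(6)[OF assms(1)]])
    (use chart_inv(2)[OF assms(1)] in auto)

lemma open_chart_preimage:
  assumes "c \<in> A" "open T"
  shows "open {x \<in> chart_image c. chart_inv c x \<in> T}"
  using continuous_open_preimage[OF chart_inv(6)[OF assms(1)] chart(2)[OF assms(1)] assms(2)]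
  by (simp add: vimage_def Int_def)

lemma chart_compact:
  assumes "c \<in> A" "compact K" "K \<subseteq> fst c"
  shows "compact (snd c ` K)" "snd c ` K \<subseteq> chart_image c"
    "x \<in> chart_image c - snd c ` K \<Longrightarrow> chart_inv c x \<notin> K"
proof -
  show "compact (snd c ` K)"
    using compact_continuous_image[OF continuous_on_subset[OF chart_inv(7)[OF assms(1)] assms(3)] assms(2)] .
  show "snd c ` K \<subseteq> chart_image c" using assms(3) by (auto simp: chart_image_def)
  show "x \<in> chart_image c - snd c ` K \<Longrightarrow> chart_inv c x \<notin> K"
    using chart_inv(3)[OF assms(1), of x] by force
qed

definition C1_fun :: "('a \<Rightarrow> real) \<Rightarrow> bool" where
  "C1_fun f \<longleftrightarrow> (\<forall>c\<in>A. Ck_on (Suc 0) (chart_image c) (f \<circ> chart_inv c))"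

lemma C1_fun_continuous: "C1_fun f \<Longrightarrow> continuous_on M f"
  unfolding C1_fun_def using C1_on_continuous continuous_on_M by blast

text \<open>The chain rule: \<open>d f\<close> obeys the transformation law of 1-forms, which makes
  \<open>d0_wedge\<close> a form.\<close>

lemma frechet_derivative_transition:
  assumes "C1_fun f" "c \<in> A" "d \<in> A" "x \<in> overlap c d"
  shows "frechet_derivative (f \<circ> chart_inv c) (at x) u =
    frechet_derivative (f \<circ> chart_inv d) (at (transition c d x)) (dtransition c d x u)"
proof -
  let ?\<phi> = "transition c d"
  have "((f \<circ> chart_inv d) has_derivative frechet_derivative (f \<circ> chart_inv d) (at (?\<phi> x))) (at (?\<phi> x))"
    using assms transition(2)[OF assms(2-4)] unfolding C1_fun_def by (intro C1_onD) auto
  from has_derivative_compose[OF has_derivative_transition[OF assms(2-4)] this]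
  have "((\<lambda>y. (f \<circ> chart_inv d) (?\<phi> y)) has_derivative
      (\<lambda>u. frechet_derivative (f \<circ> chart_inv d) (at (?\<phi> x)) (dtransition c d x u))) (at x)" .
  moreover have "(f \<circ> chart_inv d) (?\<phi> y) = (f \<circ> chart_inv c) y" if "y \<in> overlap c d" for y
    using transition(3)[OF assms(2,3) that] by simp
  ultimately have "((f \<circ> chart_inv c) has_derivative
      (\<lambda>u. frechet_derivative (f \<circ> chart_inv d) (at (?\<phi> x)) (dtransition c d x u))) (at x)"
    using has_derivative_cong_open[OF open_overlap[OF assms(2,3)] assms(4),
        of "\<lambda>y. (f \<circ> chart_inv d) (?\<phi> y)" "f \<circ> chart_inv c"] by simp
  from frechet_derivative_at[OF this] show ?thesis by metis
qed

lemma frechet_derivative_off_support: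
  assumes "c \<in> A" "compact K" "\<And>p. p \<notin> K \<Longrightarrow> f p = (0::real)" "x \<in> chart_image c" "chart_inv c x \<notin> K"
  shows "frechet_derivative (f \<circ> chart_inv c) (at x) u = 0"
proof -
  have "open {y \<in> chart_image c. chart_inv c y \<in> -K}"
    using assms(1) compact_imp_closed[OF assms(2)] by (intro open_chart_preimage) auto
  then have "frechet_derivative (f \<circ> chart_inv c) (at x) = frechet_derivative (\<lambda>_. 0) (at x)"
    by (rule frechet_derivative_cong_open) (use assms in auto)
  then show ?thesis by (simp add: frechet_derivative_const)
qed

end

section \<open>Partitions of unity\<close>

lemma has_real_derivative_max_0_power2:
  "((\<lambda>t::real. (max 0 t)\<^sup>2) has_real_derivative 2 * max 0 t) (at t)"
proof -
  consider "t < 0" | "t > 0" | "t = 0" by linarith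
  then show ?thesis
  proof cases
    case 1
    have "((\<lambda>t::real. 0) has_real_derivative 0) (at t)" by simp
    then have "((\<lambda>t::real. (max 0 t)\<^sup>2) has_real_derivative 0) (at t)"
      by (rule DERIV_cong_ev[THEN iffD1, rotated -1, OF _ refl _ refl])
        (use 1 eventually_nhds_in_open[of "{..<0}" t] in \<open>auto elim!: eventually_mono\<close>)
    then show ?thesis using 1 by simp
  next
    case 2
    have "((\<lambda>t::real. t\<^sup>2) has_real_derivative 2 * t) (at t)" by (auto intro!: derivative_eq_intros)
    then have "((\<lambda>t::real. (max 0 t)\<^sup>2) has_real_derivative 2 * t) (at t)"
      by (rule DERIV_cong_ev[THEN iffD1, rotated -1, OF _ refl _ refl])
        (use 2 eventually_nhds_in_open[of "{0<..}" t] in \<open>auto elim!: eventually_mono\<close>)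
    then show ?thesis using 2 by simp
  next
    case 3
    have "((\<lambda>y::real. max 0 y) \<longlongrightarrow> max 0 0) (at 0)" by (intro tendsto_intros)
    then have "((\<lambda>y::real. max 0 y) \<longlongrightarrow> 0) (at 0)" by simp
    \<comment> \<open>For \<open>y \<noteq> 0\<close> this quotient is \<open>max 0 y\<close>
      itself.\<close>
    then have "((\<lambda>y::real. ((max 0 y)\<^sup>2 - (max 0 0)\<^sup>2) / (y - 0)) \<longlongrightarrow> 0) (at 0)"
      by (rule Lim_transform_eventually)
        (auto simp: eventually_at_filter max_def power2_eq_square)
    then show ?thesis using 3 by (simp add: has_field_derivative_iff)
  qed
qed

text \<open>For \<open>r > 0\<close> this is positive exactly on the open ball. The outer square
  makes it C^1 across the boundary sphere, where \<open>max 0\<close> alone would leave a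
  kink.\<close>

definition bump :: "real \<Rightarrow> 'b::euclidean_space \<Rightarrow> 'b \<Rightarrow> real" where
  "bump r a x = (max 0 (r\<^sup>2 - (x - a) \<bullet> (x - a)))\<^sup>2"

lemma has_derivative_bump:
  "(bump r a has_derivative (\<lambda>v. 2 * max 0 (r\<^sup>2 - (x - a) \<bullet> (x - a)) * (- 2 * ((x - a) \<bullet> v)))) (at x)"
proof -
  have "((\<lambda>x. r\<^sup>2 - (x - a) \<bullet> (x - a)) has_derivative (\<lambda>v. - 2 * ((x - a) \<bullet> v))) (at x)"
    by (auto intro!: derivative_eq_intros simp: inner_commute)
  from has_derivative_compose[OF this has_real_derivative_max_0_power2[unfolded has_field_derivative_def]]
  show ?thesis unfolding bump_def .
qed

lemma bump_pos: "r > 0 \<Longrightarrow> bump r a a > 0"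
  by (simp add: bump_def)

lemma bump_eq_0: "r > 0 \<Longrightarrow> x \<notin> cball a r \<Longrightarrow> bump r a x = 0"
proof -
  assume "r > 0" "x \<notin> cball a r"
  then have "r\<^sup>2 < (norm (x - a))\<^sup>2"
    by (intro power_strict_mono) (auto simp: dist_norm norm_minus_commute)
  then show ?thesis by (simp add: bump_def power2_norm_eq_inner)
qed

context compact_complex_surface
begin

definition chart_bump :: "'a chart \<Rightarrow> complex^2 \<Rightarrow> real \<Rightarrow> 'a \<Rightarrow> real" where
  "chart_bump d a r q = (if q \<in> fst d then bump r a (snd d q) else 0)"

text \<open>To see C^1 in another chart \<open>c\<close>, cover its image by two open sets: the
  overlap with \<open>d\<close>, where the function is \<open>bump\<close> after a transition map,
  and the points outside the compact set, where it is 0. Compact sets are closed as the space is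
  Hausdorff.\<close>

lemma chart_bump:
  assumes d: "d \<in> A" and r: "r > 0" and sub: "cball a r \<subseteq> chart_image d"
  shows "compact (chart_inv d ` cball a r)" "chart_inv d ` cball a r \<subseteq> fst d"
    "q \<notin> chart_inv d ` cball a r \<Longrightarrow> chart_bump d a r q = 0"
    "C1_fun (chart_bump d a r)"
proof -
  let ?K = "chart_inv d ` cball a r" and ?b = "chart_bump d a r"
  show K: "compact ?K"
    by (intro compact_continuous_image continuous_on_subset[OF chart_inv(6)[OF d]] sub compact_cball)
  show "?K \<subseteq> fst d" using chart_inv(1)[OF d] sub by auto
  have z: "?b q = 0" if "q \<notin> ?K" for q
  proof (cases "q \<in> fst d")
    case True
    then have "snd d q \<notin> cball a r" using that chart_inv(5)[OF d True] by force
    then have "bump r a (snd d q) = 0" by (rule bump_eq_0[OF r])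
    then show ?thesis by (simp add: chart_bump_def)
  qed (simp add: chart_bump_def)
  show "q \<notin> ?K \<Longrightarrow> ?b q = 0" by (rule z)
  show "C1_fun ?b"
    unfolding C1_fun_def
  proof
    fix c assume c: "c \<in> A"
    let ?S = "overlap c d" and ?T = "{x \<in> chart_image c. chart_inv c x \<in> -?K}" and ?\<phi> = "transition c d"
    have o: "open ?S" "open ?T"
      using open_overlap[OF c d] open_chart_preimage[OF c, of "-?K"] compact_imp_closed[OF K] by auto
    have eq: "?S \<union> ?T = chart_image c"
      using \<open>?K \<subseteq> fst d\<close> by (auto simp: overlap_eq[OF c])
    have S: "Ck_on (Suc 0) ?S (?b \<circ> chart_inv c)"
    proof (rule Ck_on_cong[OF o(1)])
      show "bump r a (?\<phi> x) = (?b \<circ> chart_inv c) x" if "x \<in> ?S" for x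
        using that by (simp add: overlap_eq[OF c] transition_def chart_bump_def)
      show "Ck_on (Suc 0) ?S (\<lambda>x. bump r a (?\<phi> x))"
      proof (rule C1_onI)
        show "((\<lambda>x. bump r a (?\<phi> x)) has_derivative (\<lambda>v. 2 * max 0 (r\<^sup>2 - (?\<phi> x - a) \<bullet> (?\<phi> x - a))
            * (- 2 * ((?\<phi> x - a) \<bullet> dtransition c d x v)))) (at x)" if "x \<in> ?S" for x
          by (rule has_derivative_compose[OF has_derivative_transition[OF c d that] has_derivative_bump])
        show "continuous_on ?S (\<lambda>x. 2 * max 0 (r\<^sup>2 - (?\<phi> x - a) \<bullet> (?\<phi> x - a))
            * (- 2 * ((?\<phi> x - a) \<bullet> dtransition c d x v)))" for v
          by (intro continuous_intros continuous_on_transition[OF c d] continuous_on_dtransition[OF c d])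
      qed
    qed
    have T: "Ck_on (Suc 0) ?T (?b \<circ> chart_inv c)"
      by (rule Ck_on_cong[OF o(2) _ Ck_on_0]) (use z in auto)
    show "Ck_on (Suc 0) (chart_image c) (?b \<circ> chart_inv c)"
      using C1_on_Un[OF o S T] unfolding eq .
  qed
qed

lemma chart_bump_nonneg: "0 \<le> chart_bump d a r q"
  by (simp add: chart_bump_def bump_def)

lemma C1_fun_sum:
  assumes "finite I" "\<And>i. i \<in> I \<Longrightarrow> C1_fun (f i)"
  shows "C1_fun (\<lambda>q. \<Sum>i\<in>I. f i q)"
  unfolding C1_fun_def
proof
  fix c assume c: "c \<in> A"
  show "Ck_on (Suc 0) (chart_image c) ((\<lambda>q. \<Sum>i\<in>I. f i q) \<circ> chart_inv c)"
    using Ck_on_sum[OF chart(2)[OF c] assms(1), of "Suc 0" "\<lambda>i. f i \<circ> chart_inv c" "\<lambda>_. 1"] assms(2) c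
    by (simp add: C1_fun_def o_def)
qed

text \<open>By compactness finitely many positivity sets of bumps cover \<open>M\<close>; dividing
  by the sum of these bumps gives the partition. The index is a point rather than a chart because
  one chart may carry several bumps.\<close>

lemma C1_partition_of_unity:
  obtains I :: "'a set" and ch K \<sigma> where "finite I"
    "\<And>p. p \<in> I \<Longrightarrow> ch p \<in> A" "\<And>p. p \<in> I \<Longrightarrow> compact (K p)" "\<And>p. p \<in> I \<Longrightarrow> K p \<subseteq> fst (ch p)"
    "\<And>p. p \<in> I \<Longrightarrow> C1_fun (\<sigma> p)" "\<And>p q. p \<in> I \<Longrightarrow> 0 \<le> \<sigma> p q"
    "\<And>p q. p \<in> I \<Longrightarrow> q \<notin> K p \<Longrightarrow> \<sigma> p q = 0" "\<And>q. q \<in> M \<Longrightarrow> (\<Sum>p\<in>I. \<sigma> p q) = 1"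
proof -
  have "\<forall>p\<in>M. \<exists>d. d \<in> A \<and> p \<in> fst d" using chart_covers by blast
  from bchoice[OF this] obtain ch where ch: "\<And>p. p \<in> M \<Longrightarrow> ch p \<in> A" "\<And>p. p \<in> M \<Longrightarrow> p \<in> fst (ch p)"
    by blast
  have "\<forall>p\<in>M. \<exists>e. 0 < e \<and> cball (snd (ch p) p) e \<subseteq> chart_image (ch p)"
  proof
    fix p assume p: "p \<in> M"
    show "\<exists>e. 0 < e \<and> cball (snd (ch p) p) e \<subseteq> chart_image (ch p)"
      using open_contains_cball[THEN iffD1, OF chart(2)[OF ch(1)[OF p]]] chart_inv(4)[OF ch(1)[OF p] ch(2)[OF p]]
      by simp
  qed
  from bchoice[OF this] obtain r where "\<And>p. p \<in> M \<Longrightarrow> r p > 0"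
    "\<And>p. p \<in> M \<Longrightarrow> cball (snd (ch p) p) (r p) \<subseteq> chart_image (ch p)"
    by blast
  note chr = ch this
  define b where "b = (\<lambda>p. chart_bump (ch p) (snd (ch p) p) (r p))"
  define K where "K = (\<lambda>p. chart_inv (ch p) ` cball (snd (ch p) p) (r p))"
  have cb: "compact (K p)" "K p \<subseteq> fst (ch p)" "q \<notin> K p \<Longrightarrow> b p q = 0" "C1_fun (b p)" if "p \<in> M" for p q
    using chart_bump[OF chr(1)[OF that] chr(3)[OF that] chr(4)[OF that]] unfolding b_def K_def by blast+
  have "\<exists>T. open T \<and> M \<inter> b p -` {0<..} = M \<inter> T" if "p \<in> M" for p
    using continuous_openin_preimage_gen[OF C1_fun_continuous[OF cb(4)[OF that]], of "{0<..}"]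
    by (auto simp: openin_open)
  then have "\<forall>p\<in>M. \<exists>T. open T \<and> M \<inter> b p -` {0<..} = M \<inter> T" by blast
  from bchoice[OF this] obtain T where T: "\<And>p. p \<in> M \<Longrightarrow> open (T p)" "\<And>p. p \<in> M \<Longrightarrow> M \<inter> b p -` {0<..} = M \<inter> T p"
    by blast
  have bpos: "b p p > 0" if "p \<in> M" for p
    using chr[OF that] bump_pos by (simp add: b_def chart_bump_def)
  have "M \<subseteq> (\<Union>p\<in>M. T p)" using bpos T(2) by blast
  then obtain I where I: "I \<subseteq> M" "finite I" "M \<subseteq> (\<Union>p\<in>I. T p)"
    using compactE_image[OF compact, of M T] T(1) by blast
  define s where "s = (\<lambda>q. \<Sum>p\<in>I. b p q)"
  have sC: "C1_fun s" unfolding s_def using cb(4) I by (intro C1_fun_sum) auto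
  have bn: "0 \<le> b p q" for p q by (simp add: b_def chart_bump_nonneg)
  have spos: "s q > 0" if q: "q \<in> M" for q
  proof -
    obtain p where p: "p \<in> I" "q \<in> T p" using I q by blast
    then have "b p q > 0" using T(2)[of p] I(1) q by blast
    then show ?thesis unfolding s_def using p(1) I(2) bn by (intro sum_pos2) auto
  qed
  show ?thesis
  proof
    show "C1_fun (\<lambda>q. b p q / s q)" if "p \<in> I" for p
      unfolding C1_fun_def
    proof
      fix c assume c: "c \<in> A"
      have "Ck_on (Suc 0) (chart_image c) (\<lambda>x. (b p \<circ> chart_inv c) x / (s \<circ> chart_inv c) x)"
      proof (rule C1_on_divide)
        show "(s \<circ> chart_inv c) x \<noteq> 0" if "x \<in> chart_image c" for x
          using spos[OF chart_inv(2)[OF c that]] by simp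
      qed (use sC cb(4)[of p] that I(1) c in \<open>auto simp only: C1_fun_def\<close>)
      then show "Ck_on (Suc 0) (chart_image c) ((\<lambda>q. b p q / s q) \<circ> chart_inv c)" by (simp add: o_def)
    qed
    show "(\<Sum>p\<in>I. b p q / s q) = 1" if "q \<in> M" for q
      using spos[OF that] by (simp add: sum_divide_distrib[symmetric] s_def)
    \<comment> \<open>This includes points where \<open>s q\<close> is 0; the quotient is then 0 by
      convention.\<close>
    show "0 \<le> b p q / s q" for p q
      unfolding s_def using bn by (intro divide_nonneg_nonneg sum_nonneg) auto
    show "finite I" by (rule I)
    fix p assume "p \<in> I"
    then have p: "p \<in> M" using I(1) by blast
    show "ch p \<in> A" by (rule ch(1)[OF p])
    show "compact (K p)" "K p \<subseteq> fst (ch p)" by (rule cb[OF p])+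
    show "b p q / s q = 0" if "q \<notin> K p" for q using cb(3)[OF p that] by simp
  qed
qed

text \<open>Gives meaning to the choice in \<open>manifold_integral\<close>. Since that definition
  indexes by charts, the functions \<open>\<sigma> p\<close> belonging to the same chart are
  added.\<close>

lemma partition_of_unity_exists: "\<exists>\<rho>. partition_of_unity M A \<rho>"
proof -
  obtain I :: "'a set" and ch K \<sigma> where I: "finite I"
    "\<And>p. p \<in> I \<Longrightarrow> ch p \<in> A" "\<And>p. p \<in> I \<Longrightarrow> compact (K p)" "\<And>p. p \<in> I \<Longrightarrow> K p \<subseteq> fst (ch p)"
    "\<And>p. p \<in> I \<Longrightarrow> C1_fun (\<sigma> p)" "\<And>p q. p \<in> I \<Longrightarrow> 0 \<le> \<sigma> p q"
    "\<And>p q. p \<in> I \<Longrightarrow> q \<notin> K p \<Longrightarrow> \<sigma> p q = 0" "\<And>q. q \<in> M \<Longrightarrow> (\<Sum>p\<in>I. \<sigma> p q) = 1"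
    using C1_partition_of_unity by blast
  define \<rho> where "\<rho> = (\<lambda>c q. \<Sum>p\<in>{p\<in>I. ch p = c}. \<sigma> p q)"
  let ?C = "{c\<in>A. \<exists>p\<in>M. \<rho> c p \<noteq> 0}"
  have C: "?C \<subseteq> ch ` I"
  proof
    fix c assume "c \<in> ?C"
    then have "{p\<in>I. ch p = c} \<noteq> {}" by (force simp: \<rho>_def)
    then show "c \<in> ch ` I" by auto
  qed
  have "partition_of_unity M A \<rho>"
    unfolding partition_of_unity_def
  proof (intro conjI ballI)
    show "finite ?C" using C I(1) finite_surj by blast
    fix c assume c: "c \<in> A"
    show "continuous_on M (\<rho> c)"
      unfolding \<rho>_def using I(5) C1_fun_continuous by (intro continuous_on_sum) auto
    show "0 \<le> \<rho> c p" for p unfolding \<rho>_def using I(6) by (intro sum_nonneg) auto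
    \<comment> \<open>A finite union of compact subsets of the chart domain: it is closed and hence
      contains the closure of the support.\<close>
    let ?L = "\<Union>p\<in>{p\<in>I. ch p = c}. K p"
    have "closed ?L" using I(1,3) by (intro closed_UN) (auto intro: compact_imp_closed)
    moreover have "q \<in> ?L" if "\<rho> c q \<noteq> 0" for q
      using that I(7) unfolding \<rho>_def by (metis (mono_tags, lifting) UN_I mem_Collect_eq sum.neutral)
    ultimately have "closure {p\<in>M. \<rho> c p \<noteq> 0} \<subseteq> ?L" by (intro closure_minimal) auto
    then show "M \<inter> closure {p\<in>M. \<rho> c p \<noteq> 0} \<subseteq> fst c" using I(4) by blast
  next
    fix q assume q: "q \<in> M"
    have "(\<Sum>c\<in>?C. \<rho> c q) = (\<Sum>c\<in>ch ` I. \<rho> c q)"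
      using C I(1,2) q by (intro sum.mono_neutral_left) auto
    also have "\<dots> = (\<Sum>p\<in>I. \<sigma> p q)"
      unfolding \<rho>_def by (rule sum.image_gen[OF I(1), symmetric])
    finally show "(\<Sum>c\<in>?C. \<rho> c q) = 1" using I(8)[OF q] by simp
  qed
  then show ?thesis by blast
qed

end

section \<open>Integration of products of two-forms\<close>

context compact_complex_surface
begin

text \<open>The continuous counterpart of \<open>smooth_2form\<close>. Cutting off by C^1 functions
  leads out of the smooth forms, while continuity and the pull-back law survive and carry the
  integration theory.\<close>

definition form2 :: "'a form2 \<Rightarrow> bool" where
  "form2 F \<longleftrightarrow>
     (\<forall>c\<in>A. (\<forall>x\<in>chart_image c. bilinear (F c x) \<and> (\<forall>u v. F c x u v = - F c x v u)) \<and>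
            (\<forall>u v. continuous_on (chart_image c) (\<lambda>x. F c x u v))) \<and>
     (\<forall>c\<in>A. \<forall>d\<in>A. \<forall>x\<in>overlap c d. \<forall>u v.
        F c x u v = F d (transition c d x) (dtransition c d x u) (dtransition c d x v))"

lemma form2D:
  assumes "form2 F" "c \<in> A"
  shows "x \<in> chart_image c \<Longrightarrow> bilinear (F c x)" "x \<in> chart_image c \<Longrightarrow> F c x u v = - F c x v u"
    "continuous_on (chart_image c) (\<lambda>x. F c x u v)"
    "d \<in> A \<Longrightarrow> x \<in> overlap c d \<Longrightarrow> F c x u v = F d (transition c d x) (dtransition c d x u) (dtransition c d x v)"
proof -
  show "x \<in> chart_image c \<Longrightarrow> F c x u v = - F c x v u"
    using assms unfolding form2_def by meson
qed (use assms in \<open>simp_all only: form2_def\<close>)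

lemma smooth_2form_form2:
  assumes "smooth_2form A F"
  shows "form2 F"
proof -
  have "continuous_on (chart_image c) (\<lambda>x. F c x u v)" if "c \<in> A" for c u v
  proof -
    have "smooth_on (chart_image c) (\<lambda>x. F c x u v)"
      using assms that unfolding smooth_2form_def by blast
    then have "Ck_on 0 (chart_image c) (\<lambda>x. F c x u v)" unfolding smooth_on_def by blast
    then show ?thesis by simp
  qed
  then show ?thesis using assms unfolding smooth_2form_def form2_def by blast
qed

lemma form2_mult2:
  assumes "form2 F" "continuous_on M f"
  shows "form2 (mult2 f F)"
  unfolding form2_def mult2_def
proof (intro conjI ballI allI)
  fix c assume c: "c \<in> A"
  { fix x assume x: "x \<in> chart_image c"
    note b = form2D(1)[OF assms(1) c x]
    show "bilinear (\<lambda>u v. f (chart_inv c x) * F c x u v)"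
      unfolding bilinear_def
      by (intro conjI allI linearI)
        (simp_all add: bilinear_ladd[OF b] bilinear_radd[OF b] bilinear_lmul[OF b] bilinear_rmul[OF b] algebra_simps)
    show "f (chart_inv c x) * F c x u v = - (f (chart_inv c x) * F c x v u)" for u v
      using form2D(2)[OF assms(1) c x, of u v] by simp }
  show "continuous_on (chart_image c) (\<lambda>x. f (chart_inv c x) * F c x u v)" for u v
    by (intro continuous_on_mult continuous_on_chart_inv c assms form2D(3)[OF assms(1) c])
  fix d x u v assume d: "d \<in> A" and x: "x \<in> overlap c d"
  show "f (chart_inv c x) * F c x u v =
    f (chart_inv d (transition c d x)) * F d (transition c d x) (dtransition c d x u) (dtransition c d x v)"
    using form2D(4)[OF assms(1) c d x] transition(3)[OF c d x] by simp
qed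

lemma form2_add2:
  assumes "form2 F" "form2 G"
  shows "form2 (add2 F G)"
  unfolding form2_def add2_def
proof (intro conjI ballI allI)
  fix c assume c: "c \<in> A"
  { fix x assume x: "x \<in> chart_image c"
    note b = form2D(1)[OF assms(1) c x] and b' = form2D(1)[OF assms(2) c x]
    show "bilinear (\<lambda>u v. F c x u v + G c x u v)"
      unfolding bilinear_def
      by (intro conjI allI linearI)
        (simp_all add: bilinear_ladd[OF b] bilinear_radd[OF b] bilinear_lmul[OF b] bilinear_rmul[OF b]
          bilinear_ladd[OF b'] bilinear_radd[OF b'] bilinear_lmul[OF b'] bilinear_rmul[OF b'] algebra_simps)
    show "F c x u v + G c x u v = - (F c x v u + G c x v u)" for u v
      using form2D(2)[OF assms(1) c x, of u v] form2D(2)[OF assms(2) c x, of u v] by simp }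
  show "continuous_on (chart_image c) (\<lambda>x. F c x u v + G c x u v)" for u v
    by (intro continuous_on_add form2D(3)[OF assms(1) c] form2D(3)[OF assms(2) c])
  fix d x u v assume d: "d \<in> A" and x: "x \<in> overlap c d"
  show "F c x u v + G c x u v = F d (transition c d x) (dtransition c d x u) (dtransition c d x v)
      + G d (transition c d x) (dtransition c d x u) (dtransition c d x v)"
    using form2D(4)[OF assms(1) c d x] form2D(4)[OF assms(2) c d x] by simp
qed

lemma form2_d0_wedge:
  assumes f: "C1_fun f" and \<beta>: "smooth_1form A \<beta>"
  shows "form2 (d0_wedge f \<beta>)"
  unfolding form2_def d0_wedge_def
proof (intro conjI ballI allI)
  fix c assume c: "c \<in> A"
  have fc: "Ck_on (Suc 0) (chart_image c) (f \<circ> chart_inv c)" using f c by (simp only: C1_fun_def)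
  let ?d = "\<lambda>x. frechet_derivative (f \<circ> chart_inv c) (at x)"
  { fix x assume x: "x \<in> chart_image c"
    have l: "linear (?d x)" using C1_onD[OF fc x] by (rule has_derivative_linear)
    have l': "linear (\<beta> c x)" using \<beta> c x unfolding smooth_1form_def by blast
    show "bilinear (\<lambda>u v. ?d x u * \<beta> c x v - ?d x v * \<beta> c x u)"
      unfolding bilinear_def
      by (intro conjI allI linearI)
        (simp_all add: linear_add[OF l] linear_add[OF l'] linear_cmul[OF l] linear_cmul[OF l'] algebra_simps)
    show "?d x u * \<beta> c x v - ?d x v * \<beta> c x u = - (?d x v * \<beta> c x u - ?d x u * \<beta> c x v)" for u v
      by simp }
  have b: "continuous_on (chart_image c) (\<lambda>x. \<beta> c x u)" for u
  proof -
    have "smooth_on (chart_image c) (\<lambda>x. \<beta> c x u)" using \<beta> c unfolding smooth_1form_def by blast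
    then have "Ck_on 0 (chart_image c) (\<lambda>x. \<beta> c x u)" unfolding smooth_on_def by blast
    then show ?thesis by simp
  qed
  have d': "continuous_on (chart_image c) (\<lambda>x. ?d x u)" for u using fc by simp
  show "continuous_on (chart_image c) (\<lambda>x. ?d x u * \<beta> c x v - ?d x v * \<beta> c x u)" for u v
    by (intro continuous_on_diff continuous_on_mult b d')
  fix d x u v assume d: "d \<in> A" and x: "x \<in> overlap c d"
  let ?y = "transition c d x" and ?L = "dtransition c d x"
  have "\<beta> c x u = \<beta> d ?y (?L u)" for u
    using \<beta> c d x unfolding smooth_1form_def by blast
  then show "?d x u * \<beta> c x v - ?d x v * \<beta> c x u =
    frechet_derivative (f \<circ> chart_inv d) (at ?y) (?L u) * \<beta> d ?y (?L v)
    - frechet_derivative (f \<circ> chart_inv d) (at ?y) (?L v) * \<beta> d ?y (?L u)"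
    using frechet_derivative_transition[OF f c d x] by simp
qed

lemma continuous_on_density_wedge:
  assumes "form2 F" "form2 G" "c \<in> A"
  shows "continuous_on (chart_image c) (density (wedge F G) c)"
  unfolding density_def wedge_def
  by (intro continuous_on_add continuous_on_diff continuous_on_mult form2D(3)[OF assms(1,3)] form2D(3)[OF assms(2,3)])

lemma density_wedge_transition:
  assumes F: "form2 F" and G: "form2 G" and c: "c \<in> A" and d: "d \<in> A" and x: "x \<in> overlap c d"
  shows "density (wedge F G) c x = jac (dtransition c d x) * density (wedge F G) d (transition c d x)"
proof -
  let ?y = "transition c d x" and ?L = "dtransition c d x"
  have y: "?y \<in> chart_image d" by (rule transition(2)[OF c d x])
  have "density (wedge F G) c x =
      density (wedge (\<lambda>_ _ u v. F d ?y (?L u) (?L v)) (\<lambda>_ _ u v. G d ?y (?L u) (?L v))) d ?y"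
    unfolding density_def wedge_def form2D(4)[OF F c d x] form2D(4)[OF G c d x] ..
  also have "\<dots> = jac ?L * density (wedge (\<lambda>_ _. F d ?y) (\<lambda>_ _. G d ?y)) d ?y"
    by (rule density_wedge_pullback[OF form2D(1)[OF F d y] form2D(2)[OF F d y] form2D(1)[OF G d y] form2D(2)[OF G d y]
      linear_dtransition[OF c d x] dtransition_scale[OF c d x]])
  also have "\<dots> = jac ?L * density (wedge F G) d ?y"
    by (simp add: density_def wedge_def)
  finally show ?thesis .
qed

section \<open>The integral through its own partition of unity\<close>

definition pou :: "'a chart \<Rightarrow> 'a \<Rightarrow> real" where
  "pou = (SOME \<rho>. partition_of_unity M A \<rho>)"

definition pou_charts :: "'a chart set" where
  "pou_charts = {c\<in>A. \<exists>p\<in>M. pou c p \<noteq> 0}"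

text \<open>The closure is taken in the ambient space; intersecting with \<open>M\<close> yields a
  compact set.\<close>

definition pou_supp :: "'a chart \<Rightarrow> 'a set" where
  "pou_supp c = M \<inter> closure {p\<in>M. pou c p \<noteq> 0}"

lemma partition_of_unity_pou: "partition_of_unity M A pou"
  unfolding pou_def using partition_of_unity_exists by (rule someI_ex)

lemma pou:
  shows "finite pou_charts" "c \<in> pou_charts \<Longrightarrow> c \<in> A"
    "c \<in> A \<Longrightarrow> continuous_on M (pou c)"
    "c \<in> A \<Longrightarrow> pou_supp c \<subseteq> fst c" "compact (pou_supp c)"
    "p \<in> M \<Longrightarrow> p \<notin> pou_supp c \<Longrightarrow> pou c p = 0"
    "p \<in> M \<Longrightarrow> (\<Sum>c\<in>pou_charts. pou c p) = 1"
proof -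
  have closure: "{p\<in>M. pou c p \<noteq> 0} \<subseteq> closure {p\<in>M. pou c p \<noteq> 0}" by (rule closure_subset)
  then show "p \<in> M \<Longrightarrow> p \<notin> pou_supp c \<Longrightarrow> pou c p = 0"
    unfolding pou_supp_def by blast
  show "compact (pou_supp c)"
    unfolding pou_supp_def by (intro compact_Int_closed compact closed_closure)
qed (use partition_of_unity_pou in \<open>auto simp: partition_of_unity_def pou_charts_def pou_supp_def\<close>)

lemma manifold_integral_eq:
  "manifold_integral M A \<eta> =
    (\<Sum>c\<in>pou_charts. LINT x:chart_image c|lborel. pou c (chart_inv c x) * density \<eta> c x)"
  by (simp add: manifold_integral_def pou_charts_def pou_def Let_def)

lemma set_integrable_pou:
  assumes "form2 F" "form2 G" "c \<in> A"
  shows "set_integrable lborel (chart_image c) (\<lambda>x. pou c (chart_inv c x) * density (wedge F G) c x)"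
proof (rule set_integrable_compact_support)
  note K = chart_compact[OF assms(3) pou(5) pou(4)[OF assms(3)]]
  show "continuous_on (chart_image c) (\<lambda>x. pou c (chart_inv c x) * density (wedge F G) c x)"
    by (intro continuous_on_mult continuous_on_chart_inv pou(3) assms continuous_on_density_wedge)
  show "compact (snd c ` pou_supp c)" "snd c ` pou_supp c \<subseteq> chart_image c" by (rule K)+
  show "pou c (chart_inv c x) * density (wedge F G) c x = 0" if "x \<in> chart_image c - snd c ` pou_supp c" for x
    using K(3)[OF that] that chart_inv(2)[OF assms(3)] pou(6) by simp
qed

text \<open>Equality is asked only at points of charts, where forms carry meaning. It serves to
  split along a partition of unity, to subtract cohomologous forms, and to expand in a
  basis.\<close>

lemma manifold_integral_wedge_sum:
  assumes F: "\<And>i. i \<in> I \<Longrightarrow> form2 (F i)" and G: "form2 G"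
    and eq: "\<And>c x u v. c \<in> A \<Longrightarrow> x \<in> chart_image c \<Longrightarrow> H c x u v = (\<Sum>i\<in>I. k i * F i c x u v)"
  shows "manifold_integral M A (wedge H G) = (\<Sum>i\<in>I. k i * manifold_integral M A (wedge (F i) G))"
proof -
  have D: "density (wedge H G) c x = (\<Sum>i\<in>I. k i * density (wedge (F i) G) c x)"
    if "c \<in> A" "x \<in> chart_image c" for c x
    unfolding density_def wedge_def eq[OF that]
    by (simp add: sum_distrib_right sum.distrib sum_subtractf distrib_left right_diff_distrib mult.assoc)
  have "(LINT x:chart_image c|lborel. pou c (chart_inv c x) * density (wedge H G) c x) =
      (\<Sum>i\<in>I. k i * (LINT x:chart_image c|lborel. pou c (chart_inv c x) * density (wedge (F i) G) c x))"
    if c: "c \<in> pou_charts" for c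
  proof -
    have "(LINT x:chart_image c|lborel. pou c (chart_inv c x) * density (wedge H G) c x) =
      (LINT x|lborel. (\<Sum>i\<in>I. k i * (indicator (chart_image c) x *\<^sub>R (pou c (chart_inv c x) * density (wedge (F i) G) c x))))"
      unfolding set_lebesgue_integral_def
      by (intro Bochner_Integration.integral_cong)
        (auto simp: indicator_def D[OF pou(2)[OF c]] sum_distrib_left algebra_simps)
    also have "\<dots> = (\<Sum>i\<in>I. (LINT x|lborel. k i * (indicator (chart_image c) x *\<^sub>R (pou c (chart_inv c x) * density (wedge (F i) G) c x))))"
      using set_integrable_pou[OF F G pou(2)[OF c]]
      by (intro Bochner_Integration.integral_sum) (auto simp: set_integrable_def)
    finally show ?thesis by (simp add: set_lebesgue_integral_def)
  qed
  then show ?thesis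
    unfolding manifold_integral_eq by (simp add: sum_distrib_left sum.swap[of _ I])
qed

text \<open>The summand of each chart \<open>c\<close> is moved to \<open>d\<close> by the
  transition map. Restricting to the overlap loses nothing, since the integrand lives on
  \<open>K \<inter> pou_supp c\<close>. In \<open>d\<close> the weights then add up to 1.\<close>

lemma manifold_integral_chart_support:
  assumes F: "form2 F" and G: "form2 G" and d: "d \<in> A" and K: "compact K" "K \<subseteq> fst d"
    and z: "\<And>c x u v. c \<in> A \<Longrightarrow> x \<in> chart_image c \<Longrightarrow> chart_inv c x \<notin> K \<Longrightarrow> F c x u v = 0"
  shows "manifold_integral M A (wedge F G) = (LINT y:chart_image d|lborel. density (wedge F G) d y)"
proof -
  let ?D = "density (wedge F G)"
  have Dz: "?D c x = 0" if "c \<in> A" "x \<in> chart_image c" "chart_inv c x \<notin> K" for c x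
    by (simp add: density_def wedge_def z[OF that])
  \<comment> \<open>The summand of chart \<open>c\<close>, written in the coordinates of
    \<open>d\<close>.\<close>
  define g where "g = (\<lambda>c y. pou c (chart_inv d y) * ?D d y)"
  \<comment> \<open>Used with \<open>(a, b)\<close> equal to \<open>(c, d)\<close>,
    \<open>(d, c)\<close> and \<open>(d, d)\<close>: both sides of the change of variables, and the
    final summation in \<open>d\<close>.\<close>
  have supp: "set_integrable lborel (overlap a b) (\<lambda>x. pou c (chart_inv a x) * ?D a x)"
    if a: "a \<in> A" and c: "c \<in> A" and sub: "K \<inter> pou_supp c \<subseteq> fst a \<inter> fst b" for a b c
  proof (rule set_integrable_compact_support)
    have L: "compact (K \<inter> pou_supp c)" by (intro compact_Int K pou)
    note C = chart_compact[OF a L]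
    show "continuous_on (overlap a b) (\<lambda>x. pou c (chart_inv a x) * ?D a x)"
      by (rule continuous_on_subset[of "chart_image a"])
        (auto intro!: continuous_on_mult continuous_on_chart_inv[OF a] pou(3) c
          continuous_on_density_wedge[OF F G a] simp: overlap_eq[OF a])
    show "compact (snd a ` (K \<inter> pou_supp c))" using C(1) sub by blast
    show "snd a ` (K \<inter> pou_supp c) \<subseteq> overlap a b" using sub by (auto simp: overlap_def)
    fix x assume x: "x \<in> overlap a b - snd a ` (K \<inter> pou_supp c)"
    then have "x \<in> chart_image a" by (auto simp: overlap_eq[OF a])
    then have "chart_inv a x \<notin> K \<inter> pou_supp c" "chart_inv a x \<in> M"
      using C(3)[of x] x sub chart_inv(2)[OF a] by auto
    then show "pou c (chart_inv a x) * ?D a x = 0"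
      using Dz[OF a \<open>x \<in> chart_image a\<close>] pou(6)[of "chart_inv a x" c] by auto
  qed
  have "(LINT x:chart_image c|lborel. pou c (chart_inv c x) * ?D c x) = (LINT y:chart_image d|lborel. g c y)"
    if "c \<in> pou_charts" for c
  proof -
    have c: "c \<in> A" by (rule pou(2)[OF that])
    have sub: "K \<inter> pou_supp c \<subseteq> fst c \<inter> fst d" using pou(4)[OF c] K by blast
    let ?\<phi> = "transition c d"
    have im: "?\<phi> ` overlap c d = overlap d c" and inj: "inj_on ?\<phi> (overlap c d)"
      using bij_betw_transition[OF c d] by (auto simp: bij_betw_def)
    have eq: "pou c (chart_inv c x) * ?D c x = jac (dtransition c d x) * g c (?\<phi> x)" if "x \<in> overlap c d" for x
      using density_wedge_transition[OF F G c d that] transition(3)[OF c d that] by (simp add: g_def)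
    have "(LINT x:chart_image c|lborel. pou c (chart_inv c x) * ?D c x) =
        (LINT x:overlap c d|lborel. jac (dtransition c d x) * g c (?\<phi> x))"
      unfolding set_lebesgue_integral_def
    proof (rule Bochner_Integration.integral_cong)
      fix x
      have "x \<in> overlap c d \<Longrightarrow> x \<in> chart_image c" using transition(4)[OF c d] by blast
      \<comment> \<open>On this side it is \<open>K \<subseteq> fst d\<close> that kills the
        integrand off the overlap.\<close>
      moreover have "?D c x = 0" if "x \<in> chart_image c" "x \<notin> overlap c d"
        using Dz[OF c that(1)] that K(2) by (auto simp: overlap_eq[OF c])
      ultimately show "indicat_real (chart_image c) x *\<^sub>R (pou c (chart_inv c x) * ?D c x) =
         indicat_real (overlap c d) x *\<^sub>R (jac (dtransition c d x) * g c (?\<phi> x))"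
        using eq[of x] by (auto simp: indicator_def)
    qed simp
    also have "\<dots> = (LINT y:?\<phi> ` overlap c d|lborel. g c y)"
    proof (rule lborel_integral_holomorphic_change_of_variables[OF open_overlap[OF c d]
        has_derivative_transition[OF c d] dtransition_scale[OF c d] inj])
      have "set_integrable lborel (overlap c d) (\<lambda>x. pou c (chart_inv c x) * ?D c x)"
        by (rule supp[OF c c sub])
      then show "set_integrable lborel (overlap c d) (\<lambda>x. jac (dtransition c d x) * g c (?\<phi> x))"
        by (rule set_integrable_cong[THEN iffD1, rotated 3]) (auto simp: eq)
      show "set_integrable lborel (?\<phi> ` overlap c d) (g c)"
        unfolding im g_def using sub by (intro supp[OF d c]) auto
    qed
    also have "\<dots> = (LINT y:chart_image d|lborel. g c y)"
      unfolding im set_lebesgue_integral_def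
    proof (rule Bochner_Integration.integral_cong)
      fix y
      \<comment> \<open>On this side it is the weight \<open>pou c\<close>, supported in the domain
        of \<open>c\<close>.\<close>
      have "g c y = 0" if "y \<in> chart_image d" "y \<notin> overlap d c"
        using that pou(6)[OF chart_inv(2)[OF d that(1)], of c] pou(4)[OF c] by (auto simp: overlap_eq[OF d] g_def)
      then show "indicat_real (overlap d c) y *\<^sub>R g c y = indicat_real (chart_image d) y *\<^sub>R g c y"
        by (auto simp: indicator_def overlap_eq[OF d])
    qed simp
    finally show ?thesis .
  qed
  then have "manifold_integral M A (wedge F G) = (\<Sum>c\<in>pou_charts. LINT y:chart_image d|lborel. g c y)"
    unfolding manifold_integral_eq by simp
  also have "\<dots> = (LINT y|lborel. (\<Sum>c\<in>pou_charts. indicator (chart_image d) y *\<^sub>R g c y))"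
    unfolding set_lebesgue_integral_def
  proof (rule Bochner_Integration.integral_sum[symmetric])
    fix c assume "c \<in> pou_charts"
    then have "c \<in> A" by (rule pou(2))
    have "overlap d d = chart_image d" using chart_inv(1)[OF d] by (auto simp: overlap_eq[OF d])
    then have "set_integrable lborel (chart_image d) (g c)"
      unfolding g_def using supp[OF d \<open>c \<in> A\<close>, of d] K(2) by auto
    then show "integrable lborel (\<lambda>y. indicator (chart_image d) y *\<^sub>R g c y)" by (simp add: set_integrable_def)
  qed
  also have "\<dots> = (LINT y:chart_image d|lborel. ?D d y)"
    unfolding set_lebesgue_integral_def
    using pou(7)[OF chart_inv(2)[OF d]]
    by (intro Bochner_Integration.integral_cong) (auto simp: indicator_def g_def sum_distrib_right[symmetric])
  finally show ?thesis .
qed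

text \<open>Since \<open>F\<close> is a form that equals \<open>d \<beta>\<close> in every chart, the compatibility of \<open>d\<close> with
  pull-backs is not needed: \<open>F = \<Sum>\<^sub>p (\<sigma>\<^sub>p F + d \<sigma>\<^sub>p \<and> \<beta>)\<close> splits the integral into summands
  supported in single charts, where the integrand is exact.\<close>

lemma manifold_integral_exact_wedge_closed:
  assumes F: "form2 F" and \<beta>: "smooth_1form A \<beta>" and G: "closed_2form A G"
    and eq: "\<And>c x u v. c \<in> A \<Longrightarrow> x \<in> chart_image c \<Longrightarrow> F c x u v = d1 \<beta> c x u v"
  shows "manifold_integral M A (wedge F G) = 0"
proof -
  obtain I :: "'a set" and ch K \<sigma> where I: "finite I"
    "\<And>p. p \<in> I \<Longrightarrow> ch p \<in> A" "\<And>p. p \<in> I \<Longrightarrow> compact (K p)" "\<And>p. p \<in> I \<Longrightarrow> K p \<subseteq> fst (ch p)"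
    "\<And>p. p \<in> I \<Longrightarrow> C1_fun (\<sigma> p)" "\<And>p q. p \<in> I \<Longrightarrow> 0 \<le> \<sigma> p q"
    "\<And>p q. p \<in> I \<Longrightarrow> q \<notin> K p \<Longrightarrow> \<sigma> p q = 0" "\<And>q. q \<in> M \<Longrightarrow> (\<Sum>p\<in>I. \<sigma> p q) = 1"
    using C1_partition_of_unity by blast
  have sG: "smooth_2form A G" using G by (simp add: closed_2form_def)
  then have G2: "form2 G" by (rule smooth_2form_form2)
  \<comment> \<open>In every chart this is \<open>d (\<sigma>\<^sub>p \<beta>)\<close>. Writing
    \<open>F\<close> instead of \<open>d1 \<beta>\<close> makes the pull-back law available.\<close>
  define E where "E = (\<lambda>p. add2 (mult2 (\<sigma> p) F) (d0_wedge (\<sigma> p) \<beta>))"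
  have E: "form2 (E p)" if "p \<in> I" for p
    unfolding E_def using that by (intro form2_add2 form2_mult2 form2_d0_wedge F \<beta> I C1_fun_continuous)
  have E0: "manifold_integral M A (wedge (E p) G) = 0" if p: "p \<in> I" for p
  proof -
    have d: "ch p \<in> A" by (rule I(2)[OF p])
    let ?d = "ch p" and ?U = "chart_image (ch p)"
    note K = chart_compact[OF d I(3)[OF p] I(4)[OF p]]
    have "manifold_integral M A (wedge (E p) G) = (LINT x:?U|lborel. density (wedge (E p) G) ?d x)"
    proof (rule manifold_integral_chart_support[OF E[OF p] G2 d I(3)[OF p] I(4)[OF p]])
      fix c x u v assume c: "c \<in> A" "x \<in> chart_image c" "chart_inv c x \<notin> K p"
      have "frechet_derivative (\<sigma> p \<circ> chart_inv c) (at x) u = 0" for u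
        by (rule frechet_derivative_off_support[OF c(1) I(3)[OF p] I(7)[OF p] c(2,3)])
      then show "E p c x u v = 0"
        using I(7)[OF p c(3)] by (simp add: E_def add2_def mult2_def d0_wedge_def)
    qed
    also have "\<dots> = (LINT x:?U|lborel. density (wedge (add2 (mult2 (\<sigma> p) (d1 \<beta>)) (d0_wedge (\<sigma> p) \<beta>)) G) ?d x)"
      unfolding set_lebesgue_integral_def
      by (intro Bochner_Integration.integral_cong)
        (auto simp: indicator_def density_def wedge_def E_def add2_def mult2_def eq[OF d])
    also have "\<dots> = 0"
    proof (rule stokes_in_chart[OF refl chart(2)[OF d] _ K(1,2)])
      show "Ck_on (Suc 0) ?U (\<sigma> p \<circ> chart_inv ?d)" using I(5)[OF p] d by (simp only: C1_fun_def)
      show "\<sigma> p (chart_inv ?d x) = 0" if "x \<in> ?U - snd ?d ` K p" for x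
        using K(3)[OF that] I(7)[OF p] by blast
      show "Ck_on (Suc 0) ?U (\<lambda>x. \<beta> ?d x u)" for u
        using \<beta> d unfolding smooth_1form_def smooth_on_def by blast
      show "Ck_on (Suc 0) ?U (\<lambda>x. G ?d x u v)" for u v
        using sG d unfolding smooth_2form_def smooth_on_def by blast
      show "frechet_derivative (\<lambda>y. G ?d y v w) (at x) u - frechet_derivative (\<lambda>y. G ?d y u w) (at x) v
        + frechet_derivative (\<lambda>y. G ?d y u v) (at x) w = 0" if "x \<in> ?U" for x u v w
        using G d that unfolding closed_2form_def by blast
    qed
    finally show ?thesis .
  qed
  have "manifold_integral M A (wedge F G) = (\<Sum>p\<in>I. 1 * manifold_integral M A (wedge (E p) G))"
  proof (rule manifold_integral_wedge_sum[OF E G2])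
    fix c x u v assume c: "c \<in> A" and x: "x \<in> chart_image c"
    let ?d = "\<lambda>p. frechet_derivative (\<sigma> p \<circ> chart_inv c) (at x)"
    have one: "(\<Sum>p\<in>I. \<sigma> p (chart_inv c y)) = 1" if "y \<in> chart_image c" for y
      by (rule I(8)[OF chart_inv(2)[OF c that]])
    \<comment> \<open>Differentiating \<open>\<Sum>\<^sub>p \<sigma>\<^sub>p = 1\<close> shows that
      the terms with \<open>d \<sigma>\<^sub>p\<close> cancel. The sum is 1 on the open chart image,
      which suffices for the derivative.\<close>
    have "((\<lambda>y. \<Sum>p\<in>I. (\<sigma> p \<circ> chart_inv c) y) has_derivative (\<lambda>u. \<Sum>p\<in>I. ?d p u)) (at x)"
      using I(5) c x by (intro has_derivative_sum C1_onD) (auto simp only: C1_fun_def)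
    then have "((\<lambda>y. 1) has_derivative (\<lambda>u. \<Sum>p\<in>I. ?d p u)) (at x)"
      using has_derivative_cong_open[OF chart(2)[OF c] x, of "\<lambda>y. \<Sum>p\<in>I. (\<sigma> p \<circ> chart_inv c) y" "\<lambda>_. 1"] one by simp
    then have "(\<lambda>u. \<Sum>p\<in>I. ?d p u) = (\<lambda>_. 0)"
      by (rule has_derivative_unique) (rule has_derivative_const)
    then have zero: "(\<Sum>p\<in>I. ?d p u) = 0" for u by (rule fun_cong)
    have "(\<Sum>p\<in>I. 1 * E p c x u v) = (\<Sum>p\<in>I. \<sigma> p (chart_inv c x)) * F c x u v
        + ((\<Sum>p\<in>I. ?d p u) * \<beta> c x v - (\<Sum>p\<in>I. ?d p v) * \<beta> c x u)"
      by (simp add: E_def add2_def mult2_def d0_wedge_def sum.distrib sum_subtractf sum_distrib_right)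
    then show "F c x u v = (\<Sum>p\<in>I. 1 * E p c x u v)"
      using one[OF x] zero by simp
  qed
  then show ?thesis using E0 by simp
qed

end

section \<open>Second cohomology\<close>

lemma wedge_commute: "wedge F G = wedge G F"
  by (intro ext) (simp add: wedge_def algebra_simps)

lemma intersection_form_commute: "intersection_form M A C D = intersection_form M A D C"
  by (simp add: intersection_form_def wedge_commute)

lemma smooth_on_scaled_add:
  fixes f g :: "'b::euclidean_space \<Rightarrow> real"
  shows "open S \<Longrightarrow> smooth_on S f \<Longrightarrow> smooth_on S g \<Longrightarrow> smooth_on S (\<lambda>x. f x + c * g x)"
  unfolding smooth_on_def using Ck_on_scaled_add by blast

lemma smooth_on_0: "smooth_on S (\<lambda>x. 0)"
  unfolding smooth_on_def using Ck_on_0 by blast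

lemma smooth_on_differentiable: "smooth_on S f \<Longrightarrow> x \<in> S \<Longrightarrow> f differentiable (at x)"
  unfolding smooth_on_def using Ck_on.simps(2) by blast

text \<open>For row vectors, \<open>z = k N\<close> gives \<open>z Ninv = k\<close>. The left side
  runs over pairs because \<open>H2_lincomb\<close> sums over a single finite type. In the
  application \<open>w\<close> holds the values of the representatives at a point.\<close>

lemma sum_inverse_matrix:
  fixes N Ninv :: "real^'n^'n"
  assumes "N ** Ninv = mat 1" and z: "\<And>a. z a = (\<Sum>c\<in>UNIV. k c * N $ c $ a)"
  shows "(\<Sum>i\<in>UNIV. (case i of (a, b) \<Rightarrow> Ninv $ a $ b * z a) * w (snd i)) = (\<Sum>b\<in>UNIV. k b * w b)"
proof -
  have inv: "(\<Sum>a\<in>UNIV. N $ c $ a * Ninv $ a $ b) = (if c = b then 1 else 0)" for c b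
  proof -
    have "(N ** Ninv) $ c $ b = (if c = b then 1 else 0)" by (simp add: assms(1) mat_def)
    then show ?thesis by (simp add: matrix_matrix_mult_def)
  qed
  have k: "(\<Sum>a\<in>UNIV. Ninv $ a $ b * z a) = k b" for b
  proof -
    have "(\<Sum>a\<in>UNIV. Ninv $ a $ b * z a) = (\<Sum>a\<in>UNIV. \<Sum>c\<in>UNIV. k c * (N $ c $ a * Ninv $ a $ b))"
      by (simp add: z sum_distrib_left mult_ac)
    also have "\<dots> = (\<Sum>c\<in>UNIV. k c * (\<Sum>a\<in>UNIV. N $ c $ a * Ninv $ a $ b))"
      by (subst sum.swap) (simp add: sum_distrib_left)
    finally show ?thesis by (simp add: inv if_distrib cong: if_cong)
  qed
  have "(\<Sum>i\<in>UNIV. (case i of (a, b) \<Rightarrow> Ninv $ a $ b * z a) * w (snd i)) =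
      (\<Sum>a\<in>UNIV. \<Sum>b\<in>UNIV. Ninv $ a $ b * z a * w b)"
    by (simp add: sum.cartesian_product case_prod_unfold UNIV_Times_UNIV)
  also have "\<dots> = (\<Sum>b\<in>UNIV. (\<Sum>a\<in>UNIV. Ninv $ a $ b * z a) * w b)"
    by (subst sum.swap) (simp add: sum_distrib_right)
  finally show ?thesis by (simp add: k)
qed

section \<open>Closed forms modulo exact forms\<close>

context compact_complex_surface
begin

lemma smooth_1form_0: "smooth_1form A (\<lambda>c x u. 0)"
  by (simp add: smooth_1form_def smooth_on_0 linear_zero)

lemma smooth_1form_scaled_add:
  assumes "smooth_1form A \<beta>" "smooth_1form A \<gamma>"
  shows "smooth_1form A (\<lambda>c x u. \<beta> c x u + k * \<gamma> c x u)"
  unfolding smooth_1form_def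
proof (intro conjI ballI allI)
  fix c assume c: "c \<in> A"
  { fix x assume x: "x \<in> chart_image c"
    have "linear (\<beta> c x)" "linear (\<gamma> c x)"
      using assms c x unfolding smooth_1form_def by blast+
    then show "linear (\<lambda>u. \<beta> c x u + k * \<gamma> c x u)"
      by (intro linearI) (simp_all add: linear_add linear_cmul algebra_simps) }
  { fix u
    have "smooth_on (chart_image c) (\<lambda>x. \<beta> c x u)" "smooth_on (chart_image c) (\<lambda>x. \<gamma> c x u)"
      using assms c unfolding smooth_1form_def by blast+
    then show "smooth_on (chart_image c) (\<lambda>x. \<beta> c x u + k * \<gamma> c x u)"
      by (rule smooth_on_scaled_add[OF chart(2)[OF c]]) }
  fix d x u assume d: "d \<in> A" "x \<in> overlap c d"
  have "\<beta> c x u = \<beta> d (transition c d x) (dtransition c d x u)"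
    "\<gamma> c x u = \<gamma> d (transition c d x) (dtransition c d x u)"
    using assms c d unfolding smooth_1form_def by blast+
  then show "\<beta> c x u + k * \<gamma> c x u =
    \<beta> d (transition c d x) (dtransition c d x u) + k * \<gamma> d (transition c d x) (dtransition c d x u)"
    by simp
qed

lemma d1_scaled_add:
  assumes "smooth_1form A \<beta>" "smooth_1form A \<gamma>" "c \<in> A" "x \<in> chart_image c"
  shows "d1 (\<lambda>c x u. \<beta> c x u + k * \<gamma> c x u) c x u v = d1 \<beta> c x u v + k * d1 \<gamma> c x u v"
proof -
  have "(\<lambda>x. \<beta> c x u) differentiable (at x)" "(\<lambda>x. \<gamma> c x u) differentiable (at x)" for u
    using assms unfolding smooth_1form_def by (meson smooth_on_differentiable)+
  then show ?thesis
    unfolding d1_def by (simp add: frechet_derivative_scaled_add algebra_simps)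
qed

lemma closed_2form_0: "closed_2form A (\<lambda>c x u v. 0)"
  by (auto simp: closed_2form_def smooth_2form_def smooth_on_0 linear_zero bilinear_def frechet_derivative_const)

lemma closed_2form_scaled_add:
  assumes F: "closed_2form A F" and G: "closed_2form A G"
  shows "closed_2form A (\<lambda>c x u v. F c x u v + k * G c x u v)"
proof -
  have s: "smooth_2form A F" "smooth_2form A G" using F G by (simp_all add: closed_2form_def)
  note f = s[THEN smooth_2form_form2]
  have sm: "smooth_on (chart_image c) (\<lambda>x. F c x u v)" "smooth_on (chart_image c) (\<lambda>x. G c x u v)"
    if "c \<in> A" for c u v
    using s that unfolding smooth_2form_def by blast+
  \<comment> \<open>Bilinearity, alternation and the pull-back law come from \<open>form2\<close>;
    smoothness and closedness are checked directly.\<close>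
  have "form2 (add2 F (mult2 (\<lambda>_. k) G))"
    by (intro form2_add2 form2_mult2 f continuous_on_const)
  then have f2: "form2 (\<lambda>c x u v. F c x u v + k * G c x u v)"
    by (simp add: add2_def[abs_def] mult2_def[abs_def])
  have "smooth_2form A (\<lambda>c x u v. F c x u v + k * G c x u v)"
    unfolding smooth_2form_def
  proof (intro conjI ballI allI)
    fix c assume c: "c \<in> A"
    note D = form2D[OF f2 c]
    show "bilinear (\<lambda>u v. F c x u v + k * G c x u v)" if "x \<in> chart_image c" for x using D(1)[OF that] .
    show "F c x u v + k * G c x u v = - (F c x v u + k * G c x v u)" if "x \<in> chart_image c" for x u v
      using D(2)[OF that] .
    show "smooth_on (chart_image c) (\<lambda>x. F c x u v + k * G c x u v)" for u v
      by (rule smooth_on_scaled_add[OF chart(2)[OF c] sm[OF c]])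
  next
    fix c d x u v assume "c \<in> A" "d \<in> A" "x \<in> overlap c d"
    then show "F c x u v + k * G c x u v =
      F d (transition c d x) (dtransition c d x u) (dtransition c d x v)
      + k * G d (transition c d x) (dtransition c d x u) (dtransition c d x v)"
      by (rule form2D(4)[OF f2])
  qed
  moreover have "frechet_derivative (\<lambda>y. F c y v w + k * G c y v w) (at x) u
        - frechet_derivative (\<lambda>y. F c y u w + k * G c y u w) (at x) v
        + frechet_derivative (\<lambda>y. F c y u v + k * G c y u v) (at x) w = 0"
    if c: "c \<in> A" and x: "x \<in> chart_image c" for c x u v w
  proof -
    note D = frechet_derivative_scaled_add[OF sm[OF c, THEN smooth_on_differentiable[OF _ x]]]
    have "frechet_derivative (\<lambda>y. F c y v w) (at x) u - frechet_derivative (\<lambda>y. F c y u w) (at x) v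
        + frechet_derivative (\<lambda>y. F c y u v) (at x) w = 0"
      "frechet_derivative (\<lambda>y. G c y v w) (at x) u - frechet_derivative (\<lambda>y. G c y u w) (at x) v
        + frechet_derivative (\<lambda>y. G c y u v) (at x) w = 0"
      using F G c x unfolding closed_2form_def by blast+
    then show ?thesis unfolding D by algebra
  qed
  ultimately show ?thesis by (simp add: closed_2form_def)
qed

lemma cohomologousI:
  assumes "closed_2form A F" "closed_2form A G" "smooth_1form A \<beta>"
    "\<And>c x u v. c \<in> A \<Longrightarrow> x \<in> chart_image c \<Longrightarrow> F c x u v - G c x u v = d1 \<beta> c x u v"
  shows "(F, G) \<in> cohomologous A"
  using assms unfolding cohomologous_def by blast

lemma cohomologousE:
  assumes "(F, G) \<in> cohomologous A"
  obtains \<beta> where "closed_2form A F" "closed_2form A G" "smooth_1form A \<beta>"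
    "\<And>c x u v. c \<in> A \<Longrightarrow> x \<in> chart_image c \<Longrightarrow> F c x u v - G c x u v = d1 \<beta> c x u v"
  using assms unfolding cohomologous_def by blast

lemma cohomologous_refl:
  assumes "closed_2form A F"
  shows "(F, F) \<in> cohomologous A"
  by (rule cohomologousI[OF assms assms smooth_1form_0]) (simp add: d1_def frechet_derivative_const)

lemma cohomologous_scaled_add:
  assumes "(F, F') \<in> cohomologous A" "(G, G') \<in> cohomologous A"
  shows "(\<lambda>c x u v. F c x u v + k * G c x u v, \<lambda>c x u v. F' c x u v + k * G' c x u v) \<in> cohomologous A"
proof -
  obtain \<beta> where \<beta>: "closed_2form A F" "closed_2form A F'" "smooth_1form A \<beta>"
    "\<And>c x u v. c \<in> A \<Longrightarrow> x \<in> chart_image c \<Longrightarrow> F c x u v - F' c x u v = d1 \<beta> c x u v"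
    by (rule cohomologousE[OF assms(1)], rule that) blast+
  obtain \<gamma> where \<gamma>: "closed_2form A G" "closed_2form A G'" "smooth_1form A \<gamma>"
    "\<And>c x u v. c \<in> A \<Longrightarrow> x \<in> chart_image c \<Longrightarrow> G c x u v - G' c x u v = d1 \<gamma> c x u v"
    by (rule cohomologousE[OF assms(2)], rule that) blast+
  show ?thesis
  proof (rule cohomologousI[OF closed_2form_scaled_add[OF \<beta>(1) \<gamma>(1)] closed_2form_scaled_add[OF \<beta>(2) \<gamma>(2)]
      smooth_1form_scaled_add[OF \<beta>(3) \<gamma>(3)]])
    fix c x u v assume "c \<in> A" "x \<in> chart_image c"
    then show "F c x u v + k * G c x u v - (F' c x u v + k * G' c x u v) =
        d1 (\<lambda>c x u. \<beta> c x u + k * \<gamma> c x u) c x u v"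
      unfolding d1_scaled_add[OF \<beta>(3) \<gamma>(3) \<open>c \<in> A\<close> \<open>x \<in> chart_image c\<close>]
      by (simp add: \<beta>(4)[symmetric] \<gamma>(4)[symmetric] algebra_simps)
  qed
qed

lemma cohomologous_sym:
  assumes "(F, G) \<in> cohomologous A"
  shows "(G, F) \<in> cohomologous A"
proof -
  obtain \<beta> where \<beta>: "closed_2form A F" "closed_2form A G" "smooth_1form A \<beta>"
    "\<And>c x u v. c \<in> A \<Longrightarrow> x \<in> chart_image c \<Longrightarrow> F c x u v - G c x u v = d1 \<beta> c x u v"
    by (rule cohomologousE[OF assms], rule that) blast+
  show ?thesis
  \<comment> \<open>The primitive is -\<beta>, written as \<open>0 + (-1) * \<beta>\<close> to fit
    the closure rule for 1-forms.\<close>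
  proof (rule cohomologousI[OF \<beta>(2,1) smooth_1form_scaled_add[OF smooth_1form_0 \<beta>(3), of "-1"]])
    fix c x u v assume c: "c \<in> A" "x \<in> chart_image c"
    have "d1 (\<lambda>c x u. 0 + (-1) * \<beta> c x u) c x u v = - d1 \<beta> c x u v"
      unfolding d1_scaled_add[OF smooth_1form_0 \<beta>(3) c] by (simp add: d1_def frechet_derivative_const)
    then show "G c x u v - F c x u v = d1 (\<lambda>c x u. 0 + (-1) * \<beta> c x u) c x u v"
      using \<beta>(4)[OF c, of u v] by linarith
  qed
qed

lemma cohomologous_trans:
  assumes "(F, G) \<in> cohomologous A" "(G, H) \<in> cohomologous A"
  shows "(F, H) \<in> cohomologous A"
proof -
  obtain \<beta> where \<beta>: "closed_2form A F" "closed_2form A G" "smooth_1form A \<beta>"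
    "\<And>c x u v. c \<in> A \<Longrightarrow> x \<in> chart_image c \<Longrightarrow> F c x u v - G c x u v = d1 \<beta> c x u v"
    by (rule cohomologousE[OF assms(1)], rule that) blast+
  obtain \<gamma> where \<gamma>: "closed_2form A G" "closed_2form A H" "smooth_1form A \<gamma>"
    "\<And>c x u v. c \<in> A \<Longrightarrow> x \<in> chart_image c \<Longrightarrow> G c x u v - H c x u v = d1 \<gamma> c x u v"
    by (rule cohomologousE[OF assms(2)], rule that) blast+
  show ?thesis
  proof (rule cohomologousI[OF \<beta>(1) \<gamma>(2) smooth_1form_scaled_add[OF \<beta>(3) \<gamma>(3), of 1]])
    fix c x u v assume c: "c \<in> A" "x \<in> chart_image c"
    show "F c x u v - H c x u v = d1 (\<lambda>c x u. \<beta> c x u + 1 * \<gamma> c x u) c x u v"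
      unfolding d1_scaled_add[OF \<beta>(3) \<gamma>(3) c] using \<beta>(4)[OF c, of u v] \<gamma>(4)[OF c, of u v] by linarith
  qed
qed

lemma equiv_cohomologous: "equiv {F. closed_2form A F} (cohomologous A)"
proof (rule equivI)
  show "cohomologous A \<subseteq> {F. closed_2form A F} \<times> {F. closed_2form A F}"
    by (auto simp: cohomologous_def)
  show "refl_on {F. closed_2form A F} (cohomologous A)"
    using cohomologous_refl by (auto simp: refl_on_def cohomologous_def)
  show "sym (cohomologous A)" using cohomologous_sym by (rule symI)
  show "trans (cohomologous A)" using cohomologous_trans by (rule transI)
qed

lemma closed_2form_sum:
  assumes "finite I" "\<And>i. i \<in> I \<Longrightarrow> closed_2form A (F i)"
  shows "closed_2form A (\<lambda>c x u v. \<Sum>i\<in>I. k i * F i c x u v)"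
  using assms
proof (induction rule: finite_induct)
  case (insert i I)
  then show ?case
    using closed_2form_scaled_add[of "\<lambda>c x u v. \<Sum>i\<in>I. k i * F i c x u v" "F i" "k i"]
    by (simp add: add.commute)
qed (simp add: closed_2form_0)

section \<open>Representatives and the pairing of classes\<close>

lemma cls_in_H2: "closed_2form A F \<Longrightarrow> cls A F \<in> H2 A"
  unfolding cls_def H2_def by (rule quotientI) simp

text \<open>Reflexivity makes the class nonempty, so the choice made by \<open>rep\<close> stays
  inside it.\<close>

lemma cohomologous_rep_cls:
  assumes "closed_2form A F"
  shows "(F, rep (cls A F)) \<in> cohomologous A"
proof -
  have "F \<in> cls A F" unfolding cls_def using cohomologous_refl[OF assms] by simp
  then have "rep (cls A F) \<in> cls A F" unfolding rep_def by (rule someI[of "\<lambda>F'. F' \<in> cls A F"])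
  then show ?thesis by (simp add: cls_def)
qed

lemma closed_2form_rep:
  assumes "C \<in> H2 A"
  shows "closed_2form A (rep C)"
proof -
  obtain F where "closed_2form A F" "C = cls A F"
    using assms unfolding H2_def cls_def by (auto elim: quotientE)
  then show ?thesis using cohomologous_rep_cls[of F] by (auto simp: cohomologous_def)
qed

text \<open>The difference of the two forms obeys the pull-back law and equals
  \<open>d \<beta>\<close> in every chart, so Stokes applies to it.\<close>

lemma manifold_integral_wedge_cohomologous:
  assumes "(F, F') \<in> cohomologous A" and G: "closed_2form A G"
  shows "manifold_integral M A (wedge F G) = manifold_integral M A (wedge F' G)"
proof -
  obtain \<beta> where \<beta>: "closed_2form A F" "closed_2form A F'" "smooth_1form A \<beta>"
    "\<And>c x u v. c \<in> A \<Longrightarrow> x \<in> chart_image c \<Longrightarrow> F c x u v - F' c x u v = d1 \<beta> c x u v"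
    by (rule cohomologousE[OF assms(1)], rule that) blast+
  have form2: "form2 H" if "closed_2form A H" for H
    using that smooth_2form_form2 unfolding closed_2form_def by blast
  define H where "H = (\<lambda>c x u v. F c x u v + (-1) * F' c x u v)"
  have "form2 H" unfolding H_def by (intro form2 closed_2form_scaled_add \<beta>)
  then have "manifold_integral M A (wedge H G) = 0"
    by (rule manifold_integral_exact_wedge_closed[OF _ \<beta>(3) G]) (simp add: H_def \<beta>(4)[symmetric])
  \<comment> \<open>The two-term combination is presented as a sum over \<open>bool\<close>.\<close>
  moreover have "manifold_integral M A (wedge H G) =
    (\<Sum>i\<in>UNIV. (if i then 1 else -1) * manifold_integral M A (wedge (if i then F else F') G))"
    by (rule manifold_integral_wedge_sum) (auto simp: form2 \<beta> G H_def UNIV_bool)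
  ultimately show ?thesis by (simp add: UNIV_bool)
qed

text \<open>The representative chosen for the combination differs from the combination of the chosen
  representatives by an exact form, which pairs to 0 with closed forms.\<close>

lemma intersection_form_lincomb:
  assumes B: "\<And>i. B i \<in> H2 A" and D: "D \<in> H2 A"
  shows "intersection_form M A (H2_lincomb A k B) D = (\<Sum>i\<in>UNIV. k i * intersection_form M A (B i) D)"
proof -
  define S where "S = (\<lambda>c x u v. \<Sum>i\<in>UNIV. k i * rep (B i) c x u v)"
  have S: "closed_2form A S"
    unfolding S_def using closed_2form_rep[OF B] by (intro closed_2form_sum) auto
  have form2: "form2 H" if "closed_2form A H" for H
    using that smooth_2form_form2 unfolding closed_2form_def by blast
  have "intersection_form M A (H2_lincomb A k B) D = manifold_integral M A (wedge (rep (cls A S)) (rep D))"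
    by (simp add: intersection_form_def H2_lincomb_def S_def)
  also have "\<dots> = manifold_integral M A (wedge S (rep D))"
    by (rule manifold_integral_wedge_cohomologous[OF cohomologous_rep_cls[OF S] closed_2form_rep[OF D], symmetric])
  also have "\<dots> = (\<Sum>i\<in>UNIV. k i * manifold_integral M A (wedge (rep (B i)) (rep D)))"
    by (rule manifold_integral_wedge_sum[OF form2[OF closed_2form_rep[OF B]] form2[OF closed_2form_rep[OF D]]])
      (simp add: S_def)
  finally show ?thesis by (simp add: intersection_form_def)
qed

lemma H2_lincomb_in_H2:
  assumes "\<And>i. B i \<in> H2 A"
  shows "H2_lincomb A k B \<in> H2 A"
  unfolding H2_lincomb_def using closed_2form_rep[OF assms] by (intro cls_in_H2 closed_2form_sum) auto

text \<open>Replaces the representatives chosen inside \<open>H2_add\<close> by given ones.\<close>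

lemma H2_add_cls:
  assumes "closed_2form A F" "closed_2form A G"
  shows "H2_add A (cls A F) (cls A G) = cls A (\<lambda>c x u v. F c x u v + G c x u v)"
proof -
  have "(\<lambda>c x u v. F c x u v + 1 * G c x u v,
      \<lambda>c x u v. rep (cls A F) c x u v + 1 * rep (cls A G) c x u v) \<in> cohomologous A"
    by (intro cohomologous_scaled_add cohomologous_rep_cls assms)
  then have "(\<lambda>c x u v. F c x u v + G c x u v,
      \<lambda>c x u v. rep (cls A F) c x u v + rep (cls A G) c x u v) \<in> cohomologous A" by simp
  from equiv_class_eq[OF equiv_cohomologous this] show ?thesis
    by (simp add: H2_add_def cls_def)
qed

end

section \<open>Recovering the coefficients from the two Gram blocks\<close>

theorem mainTheorem1:
  fixes M :: "'a::t2_space set" and A :: "'a chart set"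
    and \<Omega> :: "3 \<Rightarrow> 'a form2 set" and \<Omega>' :: "19 \<Rightarrow> 'a form2 set"
    and \<K> \<K>inv :: "real^3^3" and \<K>' \<K>inv' :: "real^19^19"
    and \<alpha> :: "22 \<Rightarrow> 'a form2 set" and p :: "22 \<Rightarrow> int" and \<H> :: "'a form2 set"
    and Z :: "3 \<Rightarrow> real" and Z' :: "19 \<Rightarrow> real"
  assumes "K3_surface M A"
    and "H2_basis A (case_sum \<Omega> \<Omega>')"
    and "\<And>a I. intersection_form M A (\<Omega> a) (\<Omega>' I) = 0"
    and "\<K> = (\<chi> a b. intersection_form M A (\<Omega> a) (\<Omega> b))"
    and "\<K>' = (\<chi> I J. intersection_form M A (\<Omega>' I) (\<Omega>' J))"
    and "\<K> ** \<K>inv = mat 1" and "\<K>inv ** \<K> = mat 1"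
    and "\<K>' ** \<K>inv' = mat 1" and "\<K>inv' ** \<K>' = mat 1"
    and "H2_basis A \<alpha>"
    and "\<H> = H2_lincomb A (\<lambda>\<Lambda>. real_of_int (p \<Lambda>)) \<alpha>"
    and "\<And>a. Z a = intersection_form M A \<H> (\<Omega> a)"
    and "\<And>I. Z' I = intersection_form M A \<H> (\<Omega>' I)"
  shows "\<H> = H2_add A
           (H2_lincomb A (\<lambda>(a, b). \<K>inv $ a $ b * Z a) (\<lambda>(a, b). \<Omega> b))
           (H2_lincomb A (\<lambda>(I, J). \<K>inv' $ I $ J * Z' I) (\<lambda>(I, J). \<Omega>' J))"
proof -
  interpret compact_complex_surface M A
    using assms(1) by unfold_locales (auto simp: K3_surface_def)
  let ?B = "case_sum \<Omega> \<Omega>'"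
  have B: "?B i \<in> H2 A" for i using assms(2) by (simp only: H2_basis_def)
  have \<Omega>: "\<Omega> a \<in> H2 A" "\<Omega>' I \<in> H2 A" for a I using B[of "Inl a"] B[of "Inr I"] by simp_all
  have "\<H> \<in> H2 A"
    unfolding assms(11) using assms(10) by (intro H2_lincomb_in_H2) (simp add: H2_basis_def)
  then obtain k where k: "\<H> = H2_lincomb A k ?B"
    using assms(2) unfolding H2_basis_def by blast
  define l l' where "l = k \<circ> Inl" and "l' = k \<circ> Inr"
  \<comment> \<open>The function \<open>f\<close> of a class is first a pairing with a basis class
    and later the value of the representative at given arguments.\<close>
  have split: "(\<Sum>i\<in>UNIV. k i * f (?B i)) = (\<Sum>a\<in>UNIV. l a * f (\<Omega> a)) + (\<Sum>I\<in>UNIV. l' I * f (\<Omega>' I))" for f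
    by (simp add: UNIV_Plus_UNIV[symmetric] sum.Plus l_def l'_def del: UNIV_Plus_UNIV)
  have 0: "intersection_form M A (\<Omega>' I) (\<Omega> a) = 0" for a I
    using assms(3) by (subst intersection_form_commute)
  \<comment> \<open>Orthogonality removes the sum over the other block.\<close>
  have Z: "Z a = (\<Sum>c\<in>UNIV. l c * \<K> $ c $ a)" for a
    unfolding assms(12) k intersection_form_lincomb[OF B \<Omega>(1)] split[of "\<lambda>C. intersection_form M A C (\<Omega> a)"]
    by (simp add: assms(4) 0)
  have Z': "Z' I = (\<Sum>J\<in>UNIV. l' J * \<K>' $ J $ I)" for I
    unfolding assms(13) k intersection_form_lincomb[OF B \<Omega>(2)] split[of "\<lambda>J. intersection_form M A J (\<Omega>' I)"]
    by (simp add: assms(3,5))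
  define P where "P = (\<lambda>c x u v. \<Sum>a\<in>UNIV. l a * rep (\<Omega> a) c x u v)"
  define Q where "Q = (\<lambda>c x u v. \<Sum>I\<in>UNIV. l' I * rep (\<Omega>' I) c x u v)"
  have PQ: "closed_2form A P" "closed_2form A Q"
    unfolding P_def Q_def by (intro closed_2form_sum finite closed_2form_rep \<Omega>)+
  \<comment> \<open>Both sides use the same representatives, so the underlying forms agree
    pointwise, before classes are taken.\<close>
  have "H2_lincomb A (\<lambda>(a, b). \<K>inv $ a $ b * Z a) (\<lambda>(a, b). \<Omega> b) = cls A P"
    unfolding H2_lincomb_def P_def
    using sum_inverse_matrix[OF assms(6) Z, of "\<lambda>b. rep (\<Omega> b) _ _ _ _"]
    by (simp add: case_prod_unfold)
  moreover have "H2_lincomb A (\<lambda>(I, J). \<K>inv' $ I $ J * Z' I) (\<lambda>(I, J). \<Omega>' J) = cls A Q"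
    unfolding H2_lincomb_def Q_def
    using sum_inverse_matrix[OF assms(8) Z', of "\<lambda>J. rep (\<Omega>' J) _ _ _ _"]
    by (simp add: case_prod_unfold)
  moreover have "\<H> = cls A (\<lambda>c x u v. P c x u v + Q c x u v)"
    unfolding k H2_lincomb_def P_def Q_def using split[of "\<lambda>C. rep C _ _ _ _"] by simp
  ultimately show ?thesis by (simp add: H2_add_cls[OF PQ])
qed

end
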